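(* Let $(f_t)$ be a Loewner chain with associated evolution family $(\varphi_{s,t})$. Suppose that $\partial_\infty f_t(\mathbb{D})$ is locally connected for all $t\ge0$. Then $\varphi_{s,t}$ belongs to the disk algebra $\mathcal{A}$ for all $s\ge0$ and $t\ge s$.
   Context: $\mathbb{D}=\{z:|z|<1\}$; $\partial_\infty E$ denotes the boundary of $E$ in the Riemann sphere $\overline{\mathbb{C}}$. A holomorphic function $\varphi:\mathbb{D}\to\mathbb{C}$ belongs to the disk algebra $\mathcal{A}$ if it has a continuous extension to the closed unit disk. Loewner chain of order $d\in[1,+\infty]$: a family $(f_t)_{t\ge0}$ of holomorphic maps $f_t:\mathbb{D}\to\mathbb{C}$ such that (LC1) each $f_t$ is univalent; (LC2) $f_s(\mathbb{D})\subset f_t(\mathbb{D})$ for $0\le s\le t$; (LC3) for any compact $K\subset\mathbb{D}$ and $T>0$ there is a non-negative $k_{K,T}\in L^d([0,T],\mathbb{R})$ with $|f_s(z)-f_t(z)|\le\int_s^t k_{K,T}(\xi)\,d\xi$ for all $z\in K$, $0\le s\le t\le T$. A Loewner chain is one of some order $d\in[1,+\infty]$. Its associated evolution family is $\varphi_{s,t}:=f_t^{-1}\circ f_s:\mathbb{D}\to\mathbb{D}$, $0\le s\le t$. *)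

theory Defs
  imports "HOL-Complex_Analysis.Complex_Analysis"
begin

abbreviation unit_disk :: "complex set" where
  "unit_disk \<equiv> ball 0 1"

text \<open>Holomorphic functions on the disk are represented by total functions on the complex plane;
  only their values on the open disk matter in the definitions below.\<close>

definition disk_algebra :: "(complex \<Rightarrow> complex) set" where
  "disk_algebra = {\<phi>. \<phi> holomorphic_on unit_disk \<and>
     (\<exists>g. continuous_on (cball 0 1) g \<and> (\<forall>z\<in>unit_disk. g z = \<phi> z))}"

text \<open>The Riemann sphere is the one-point compactification of the plane: \<^term>\<open>None\<close> is the
  point at infinity and \<^term>\<open>Some z\<close> is the finite point \<open>z\<close>.\<close>

definition riemann_sphere :: "complex option topology" where
  "riemann_sphere = Alexandroff_compactification euclidean"

definition sphere_boundary :: "complex set \<Rightarrow> complex option set" where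
  "sphere_boundary E = riemann_sphere frontier_of (Some ` E)"

text \<open>Membership in \<open>L\<^sup>d([0,T], \<real>)\<close> for \<open>1 \<le> d \<le> \<infinity>\<close>, with respect to Lebesgue measure.\<close>

definition Ld_interval :: "ereal \<Rightarrow> real \<Rightarrow> (real \<Rightarrow> real) set" where
  "Ld_interval d T = {k. k \<in> borel_measurable (lebesgue_on {0..T}) \<and>
     (if d = \<infinity> then \<exists>C. AE \<xi> in lebesgue_on {0..T}. \<bar>k \<xi>\<bar> \<le> C
      else integrable (lebesgue_on {0..T}) (\<lambda>\<xi>. \<bar>k \<xi>\<bar> powr real_of_ereal d))}"

text \<open>The index set of a chain is \<open>[0,\<infinity>)\<close>; the values \<open>f t\<close> for \<open>t < 0\<close> are irrelevant.\<close>

definition loewner_chain_of_order :: "ereal \<Rightarrow> (real \<Rightarrow> complex \<Rightarrow> complex) \<Rightarrow> bool" where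
  "loewner_chain_of_order d f \<longleftrightarrow>
     (\<forall>t\<ge>0. f t holomorphic_on unit_disk \<and> inj_on (f t) unit_disk) \<and>
     (\<forall>s t. 0 \<le> s \<and> s \<le> t \<longrightarrow> f s ` unit_disk \<subseteq> f t ` unit_disk) \<and>
     (\<forall>K T. compact K \<and> K \<subseteq> unit_disk \<and> T > 0 \<longrightarrow>
        (\<exists>k \<in> Ld_interval d T. (\<forall>\<xi>\<in>{0..T}. 0 \<le> k \<xi>) \<and>
           (\<forall>z\<in>K. \<forall>s t. 0 \<le> s \<and> s \<le> t \<and> t \<le> T \<longrightarrow>
              cmod (f s z - f t z) \<le> integral\<^sup>L (lebesgue_on {s..t}) k)))"

definition loewner_chain :: "(real \<Rightarrow> complex \<Rightarrow> complex) \<Rightarrow> bool" where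
  "loewner_chain f \<longleftrightarrow> (\<exists>d\<ge>1. loewner_chain_of_order d f)"

definition evolution_family ::
    "(real \<Rightarrow> complex \<Rightarrow> complex) \<Rightarrow> real \<Rightarrow> real \<Rightarrow> complex \<Rightarrow> complex" where
  "evolution_family f s t = the_inv_into unit_disk (f t) \<circ> f s"

end

theory Submission
  imports Defs
begin

text \<open>
  Write \<open>f = f_s\<close>, \<open>g = f_t\<close>, \<open>\<phi> = g\<inverse> \<circ> f\<close> and \<open>p = \<phi> 0\<close>, so that \<open>g p = f 0\<close>. The functions
  \<open>1/(f z - f 0)\<close> and \<open>1/(g z - g p)\<close> are \<open>f\<close> and \<open>g\<close> followed by one and the same Moebius map, which
  moves a point common to both image domains to \<open>\<infinity>\<close>. The sphere boundaries thereby become compact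
  subsets of the plane, and the point at infinity needs no separate treatment.

  The first ingredient is Caratheodory's continuity theorem: if the boundary is locally connected, then
  \<open>1/(f z - f a)\<close>, for any \<open>a\<close> in the disk, has a limit at every boundary point of the disk
  (\<open>reciprocal_has_boundary_limit\<close>). A length-area estimate (\<open>short_vertical_segment\<close>) gives circular
  crosscuts around the boundary point whose images have small diameter. By local connectedness
  the ends of such an image are joined by a small continuum in the boundary. Janiszewski's theorem
  shows that image and continuum together enclose the image of the whole neighbourhood that
  the crosscut cuts off, so the oscillation there is small (\<open>oscillation_small_near_boundary_point\<close>).

  The extension of \<open>g\<close> need not be injective on the circle, so \<open>g\<inverse>\<close> itself need not extend. But let
  \<open>L\<close> be the limit of \<open>1/(f z - f 0)\<close> at a boundary point \<open>\<zeta>\<close>. The cluster set of \<open>\<phi>\<close> at \<open>\<zeta>\<close> is connected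
  and lies in the zero set of the extension of \<open>(w - p)/(g w - g p) - (w - p) L\<close> to the closed disk.
  This extension belongs to the disk algebra and does not vanish at \<open>p\<close>, and a function in the disk
  algebra that vanishes on a continuum with two points is zero
  (\<open>zero_on_continuum_imp_zero\<close>). Hence the cluster set is a single point, that is, \<open>\<phi>\<close> has a limit
  at \<open>\<zeta>\<close> (\<open>limit_at_boundary_if_clusters_in_zero_set\<close>), and boundary limits everywhere give a
  continuous extension to the closed disk.
\<close>

(* the dollar sign is used below for components of vectors only *)
no_notation fps_nth (infixl "$" 75)

section \<open>Boundary uniqueness in the disk algebra\<close>

text \<open>
  Finitely many rotations of the arc cover the circle. The product of the correspondingly rotated
  copies of \<open>Z\<close> therefore vanishes on the whole circle, hence on the disk by the maximum principle;
  a product of nonzero holomorphic functions, however, is nonzero near the origin except at the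
  origin itself.
\<close>
lemma zero_on_arc_imp_zero:
  assumes cont: "continuous_on (cball 0 1) Z" and holo: "Z holomorphic_on ball 0 1"
    and ab: "a < b" and zero: "\<And>t. a \<le> t \<Longrightarrow> t \<le> b \<Longrightarrow> Z (cis t) = 0"
    and z: "z \<in> ball 0 1"
  shows "Z z = 0"
proof -
  obtain n :: nat where n: "2 * pi / (b - a) < real n"
    using reals_Archimedean2 by blast
  have "0 < 2 * pi / (b - a)"
    using ab by simp
  then have n0: "n > 0"
    using n by (metis less_trans of_nat_0_less_iff)
  have n1: "2 * pi / n < b - a"
    using n ab n0 by (simp add: field_simps)
  define \<omega> where "\<omega> j = cis (2 * pi * real j / n)" for j :: nat
  define P where "P z = (\<Prod>j<n. Z (\<omega> j * z))" for z
  have \<omega>1: "cmod (\<omega> j * w) = cmod w" for j w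
    by (simp add: \<omega>_def norm_mult)
  have P_sphere: "P w = 0" if "cmod w = 1" for w
  proof -
    define t where "t = Arg w"
    have t: "w = cis t"
      using rcis_cmod_Arg[of w] that by (simp add: rcis_def t_def)
    \<comment> \<open>the first angle \<open>t + 2 pi m / n\<close> beyond \<open>a\<close> still lies in the arc; modulo \<open>n\<close>, \<open>m\<close> selects the factor that vanishes\<close>
    define m where "m = \<lceil>(a - t) * n / (2 * pi)\<rceil>"
    define s where "s = t + 2 * pi * m / n"
    have "(a - t) * n / (2 * pi) \<le> m" "m < (a - t) * n / (2 * pi) + 1"
      unfolding m_def by linarith+
    then have "a - t \<le> m * (2 * pi) / n" "m * (2 * pi) / n < (a - t) + 2 * pi / n"
      using n0 by (simp_all add: field_simps)
    then have "a \<le> s" "s \<le> b"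
      using n1 by (simp_all add: s_def field_simps)
    then have Zs: "Z (cis s) = 0"
      using zero by blast
    define j where "j = nat (m mod n)"
    have j: "j < n"
      unfolding j_def using n0 by (simp add: nat_less_iff)
    have "m = int j + n * (m div n)"
      unfolding j_def using n0 by simp
    then have "real_of_int m = real j + real n * real_of_int (m div n)"
      by (metis of_int_add of_int_mult of_int_of_nat_eq)
    then have s: "s = t + 2 * pi * real j / n + 2 * pi * real_of_int (m div n)"
      using n0 by (simp add: s_def field_simps)
    have "cis s = cis (2 * pi * real_of_int (m div n)) * (\<omega> j * cis t)"
      unfolding s \<omega>_def cis_mult by (simp only: add_ac)
    moreover have "cis (2 * pi * real_of_int (m div n)) = 1"
      by (rule cis_multiple_2pi) simp
    ultimately have "Z (\<omega> j * w) = 0"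
      using Zs t by simp
    then show ?thesis
      unfolding P_def using j by (meson finite_lessThan lessThan_iff prod_zero)
  qed
  have P_cont: "continuous_on (cball 0 1) P"
    unfolding P_def
    by (intro continuous_intros continuous_on_compose2[OF cont]) (auto simp: \<omega>1)
  have P_holo: "P holomorphic_on ball 0 1"
    unfolding P_def
    by (intro holomorphic_intros holomorphic_on_compose_gen[OF _ holo, unfolded o_def]) (auto simp: \<omega>1)
  have P_ball: "P w = 0" if "w \<in> ball 0 1" for w
  proof -
    have "cmod (P w) \<le> 0"
    proof (rule maximum_modulus_frontier[of P "ball 0 1"])
      show "P holomorphic_on interior (ball 0 1)"
        using P_holo by simp
      show "continuous_on (closure (ball 0 1)) P"
        using P_cont by simp
    qed (use P_sphere that in auto)
    then show ?thesis by simp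
  qed
  show ?thesis
  proof (rule ccontr)
    assume "Z z \<noteq> 0"
    then have "\<forall>\<^sub>F w in at 0. Z w \<noteq> 0 \<and> w \<in> ball 0 1"
      using non_zero_neighbour_alt[OF holo, of 0 z] z by auto
    then obtain d where d: "d > 0" "\<And>w. w \<noteq> 0 \<Longrightarrow> cmod w < d \<Longrightarrow> Z w \<noteq> 0 \<and> cmod w < 1"
      unfolding eventually_at by auto
    define w where "w = complex_of_real (d / 2)"
    have w: "w \<noteq> 0" "cmod w < d"
      using d(1) by (auto simp: w_def)
    have "Z (\<omega> j * w) \<noteq> 0" for j
      using d(2)[of "\<omega> j * w"] w \<omega>1[of j w] by (metis norm_eq_zero)
    then have "P w \<noteq> 0"
      by (simp add: P_def)
    then show False
      using P_ball[of w] d(2)[OF w] by simp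
  qed
qed

text \<open>
  If the continuum meets the open disk, its points accumulate there and the identity theorem
  applies. Otherwise it lies on the circle. If it misses a point of the circle, a branch of the
  argument is continuous on it, its values form an interval, and the continuum contains an arc.
\<close>
lemma zero_on_continuum_imp_zero:
  assumes cont: "continuous_on (cball 0 1) Z" and holo: "Z holomorphic_on ball 0 1"
    and C: "connected C" "C \<subseteq> cball 0 1" and xy: "x \<in> C" "y \<in> C" "x \<noteq> y"
    and zero: "\<And>w. w \<in> C \<Longrightarrow> Z w = 0"
    and z: "z \<in> ball 0 1"
  shows "Z z = 0"
proof (cases "C \<subseteq> sphere 0 1")
  case False
  then obtain w where w: "w \<in> C" "w \<in> ball 0 1"
    using C(2) by force
  have lim: "w islimpt C"
    using connected_imp_perfect[OF C(1) w(1)] xy by (metis singletonD)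
  have "w islimpt (C \<inter> ball 0 1)"
    unfolding islimpt_def
  proof (intro allI impI)
    fix T assume T: "w \<in> T" "open T"
    then show "\<exists>y\<in>C \<inter> ball 0 1. y \<in> T \<and> y \<noteq> w"
      using lim islimptE[of w C "T \<inter> ball 0 1"] w(2) by (metis IntE IntI open_Int open_ball)
  qed
  then show ?thesis
    using analytic_continuation[OF holo _ _ _ w(2) _ _ z, of "C \<inter> ball 0 1"] zero by auto
next
  case True
  show ?thesis
  proof (cases "C = sphere 0 1")
    case True
    then show ?thesis
      using zero_on_arc_imp_zero[OF cont holo, of 0 1 z] zero z by simp
  next
    case False
    then have "\<not> sphere 0 1 \<subseteq> C"
      using \<open>C \<subseteq> sphere 0 1\<close> by blast
    then obtain c where c: "cmod c = 1" "c \<notin> C"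
      by (metis mem_sphere_0 subsetI)
    define \<tau> where "\<tau> w = Arg (- w / c)" for w
    have eq: "w = - c * cis (\<tau> w)" if "w \<in> C" for w
    proof -
      have "cmod (- w / c) = 1"
        using that True c by (auto simp: norm_divide)
      then have "cis (\<tau> w) = - w / c"
        unfolding \<tau>_def using rcis_cmod_Arg[of "- w / c"] by (simp add: rcis_def)
      then show ?thesis using c by (auto simp: field_simps)
    qed
    have "continuous_on C \<tau>"
      unfolding \<tau>_def
    proof (rule continuous_on_compose2[of "- \<real>\<^sub>\<le>\<^sub>0" Arg])
      show "continuous_on (- \<real>\<^sub>\<le>\<^sub>0) Arg"
        by (simp add: continuous_at_Arg continuous_at_imp_continuous_on)
      show "(\<lambda>w. - w / c) ` C \<subseteq> - \<real>\<^sub>\<le>\<^sub>0"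
      proof clarify
        fix w assume w: "w \<in> C" "- w / c \<in> \<real>\<^sub>\<le>\<^sub>0"
        then have "cmod (- w / c) = 1"
          using True c by (auto simp: norm_divide)
        moreover obtain r where r: "- w / c = complex_of_real r" "r \<le> 0"
          using w(2) by (elim nonpos_Reals_cases) auto
        ultimately have "- w / c = -1"
          by (metis abs_of_nonpos minus_minus norm_of_real of_real_1 of_real_minus)
        then show False using w c by (auto simp: field_simps)
      qed
    qed (use c in \<open>auto intro!: continuous_intros\<close>)
    then have conn: "connected (\<tau> ` C)"
      using C(1) connected_continuous_image by blast
    have ne: "\<tau> x \<noteq> \<tau> y"
      using eq xy by metis
    define a where "a = min (\<tau> x) (\<tau> y)"
    define b where "b = max (\<tau> x) (\<tau> y)"
    have ab: "a < b" "a \<in> \<tau> ` C" "b \<in> \<tau> ` C"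
      using ne xy by (auto simp: a_def b_def min_def max_def)
    have sub: "{a..b} \<subseteq> \<tau> ` C"
      using connected_contains_Icc[OF conn ab(2,3)] .
    define Y where "Y w = Z (- c * w)" for w
    have "Y (- z / c) = 0"
    proof (rule zero_on_arc_imp_zero[where Z = Y and z = "- z / c", OF _ _ ab(1)])
      show "continuous_on (cball 0 1) Y"
        unfolding Y_def using c
        by (intro continuous_intros continuous_on_compose2[OF cont]) (auto simp: norm_mult)
      show "Y holomorphic_on ball 0 1"
        unfolding Y_def using c
        by (intro holomorphic_intros holomorphic_on_compose_gen[OF _ holo, unfolded o_def]) (auto simp: norm_mult)
      show "Y (cis t) = 0" if "a \<le> t" "t \<le> b" for t
        unfolding Y_def using that sub eq zero by (smt (verit) atLeastAtMost_iff image_iff subset_eq)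
      show "- z / c \<in> ball 0 1"
        using z c by (simp add: norm_divide)
    qed
    then show ?thesis
      using c by (auto simp: Y_def split: if_splits)
  qed
qed

section \<open>The length-area estimate\<close>

text \<open>
  The Cauchy-Schwarz inequality against the constant 1, from the nonnegative variance of \<open>u\<close>.
\<close>
lemma integral_square_le:
  fixes u :: "real \<Rightarrow> real"
  assumes ab: "a \<le> b" and u: "continuous_on {a..b} u"
  shows "(integral {a..b} u)\<^sup>2 \<le> (b - a) * integral {a..b} (\<lambda>t. (u t)\<^sup>2)"
proof (cases "a = b")
  case False
  define d where "d = b - a"
  define m where "m = integral {a..b} u / d"
  have d: "d > 0" using ab False by (simp add: d_def)
  have [simp]: "u integrable_on {a..b}" "(\<lambda>t. (u t)\<^sup>2) integrable_on {a..b}"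
    "(\<lambda>t. 2 * m * u t) integrable_on {a..b}"
    using u by (auto intro!: integrable_continuous_real continuous_intros)
  have "0 \<le> integral {a..b} (\<lambda>t. (u t - m)\<^sup>2)"
    by (intro integral_nonneg integrable_continuous_real continuous_intros u) auto
  also have "(\<lambda>t. (u t - m)\<^sup>2) = (\<lambda>t. ((u t)\<^sup>2 - 2 * m * u t) + m\<^sup>2)"
    by (auto simp: power2_eq_square algebra_simps)
  also have "integral {a..b} \<dots> = integral {a..b} (\<lambda>t. (u t)\<^sup>2 - 2 * m * u t) + integral {a..b} (\<lambda>t. m\<^sup>2)"
    by (intro integral_add integrable_diff) auto
  also have "\<dots> = integral {a..b} (\<lambda>t. (u t)\<^sup>2) - integral {a..b} (\<lambda>t. 2 * m * u t) + d * m\<^sup>2"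
    using ab by (subst integral_diff) (auto simp: d_def)
  also have "integral {a..b} (\<lambda>t. 2 * m * u t) = 2 * m * integral {a..b} u"
    by simp
  also have "2 * m * integral {a..b} u = 2 * (d * m\<^sup>2)"
    using d by (simp add: m_def power2_eq_square field_simps)
  finally have "d * m\<^sup>2 \<le> integral {a..b} (\<lambda>t. (u t)\<^sup>2)" by simp
  then have "d * (d * m\<^sup>2) \<le> d * integral {a..b} (\<lambda>t. (u t)\<^sup>2)"
    using d by (simp add: mult_left_mono)
  moreover have "d * (d * m\<^sup>2) = (integral {a..b} u)\<^sup>2"
    using d by (simp add: m_def power2_eq_square field_simps)
  ultimately show ?thesis by (simp add: d_def)
qed auto

text \<open>
  The change of variables formula for measures is about cartesian powers \<open>real^'n\<close>, whereas
  Fubini's theorem for continuous functions is about products; this moves integrals over rectangles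
  from one to the other.
\<close>
lemma integral_real2_eq_iterated:
  fixes u :: "real \<Rightarrow> real \<Rightarrow> real"
  assumes u: "continuous_on ({a..b} \<times> {c..d}) (\<lambda>(x, y). u x y)"
  shows "integral (cbox (vector [a, c]) (vector [b, d] :: real^2)) (\<lambda>v. u (v $ 1) (v $ 2)) =
    integral {a..b} (\<lambda>x. integral {c..d} (u x))"
proof -
  define G :: "real^2 \<Rightarrow> real \<times> real" where "G v = (v $ 1, v $ 2)" for v
  define F :: "real \<times> real \<Rightarrow> real^2" where "F q = vector [fst q, snd q]" for q
  have FG: "F (G v) = v" for v
    by (simp add: F_def G_def vec_eq_iff forall_2)
  have GF: "G (F q) = q" for q
    by (simp add: F_def G_def)
  have cb: "v \<in> cbox p q \<longleftrightarrow> G v \<in> cbox (G p) (G q)" for v p q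
    by (auto simp: G_def mem_box_cart forall_2 cbox_Pair_eq)
  have G_cbox: "G ` cbox p q = cbox (G p) (G q)" for p q
  proof (rule set_eqI)
    fix z
    have "z \<in> G ` cbox p q \<longleftrightarrow> F z \<in> cbox p q"
      by (metis FG GF imageE imageI)
    then show "z \<in> G ` cbox p q \<longleftrightarrow> z \<in> cbox (G p) (G q)"
      by (simp add: cb GF)
  qed
  have F_cbox: "F ` cbox p q = cbox (F p) (F q)" for p q
  proof (rule set_eqI)
    fix v
    have "v \<in> F ` cbox p q \<longleftrightarrow> G v \<in> cbox p q"
      by (metis FG GF imageE imageI)
    then show "v \<in> F ` cbox p q \<longleftrightarrow> v \<in> cbox (F p) (F q)"
      by (simp add: cb GF)
  qed
  define f where "f = (\<lambda>(x, y). u x y)"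
  have "(f has_integral integral (cbox (a, c) (b, d)) f) (cbox (a, c) (b, d))"
    by (intro integrable_integral integrable_continuous) (use u in \<open>auto simp: f_def cbox_Pair_eq\<close>)
  then have "((\<lambda>v. f (G v)) has_integral (1 / 1) *\<^sub>R integral (cbox (a, c) (b, d)) f) (F ` cbox (a, c) (b, d))"
  proof (rule has_integral_twiddle[rotated -1])
    show "continuous (at x) G" for x
      unfolding G_def by (intro continuous_intros)
    show "measure lborel (G ` cbox u v) = 1 * measure lborel (cbox u v)" for u v
    proof -
      have "measure lborel (cbox u v) = (if \<forall>i. u $ i \<le> v $ i then prod (\<lambda>i. v $ i - u $ i) UNIV else 0)"
      proof (cases "\<forall>i. u $ i \<le> v $ i")
        case True
        then have "cbox u v \<noteq> {}" by (simp add: interval_ne_empty_cart(1))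
        then show ?thesis using True by (simp add: content_cbox_cart)
      next
        case False
        then have "cbox u v = {}" using interval_ne_empty_cart(1) by blast
        then show ?thesis using False by auto
      qed
      then show ?thesis
        unfolding G_cbox by (auto simp: G_def content_Pair forall_2 UNIV_2 content_real_if)
    qed
    show "\<exists>w z. G ` cbox u v = cbox w z" "\<exists>w z. F ` cbox u' v' = cbox w z" for u v u' v'
      using G_cbox F_cbox by blast+
  qed (simp_all add: FG GF)
  moreover have "F ` cbox (a, c) (b, d) = cbox (vector [a, c]) (vector [b, d])"
    unfolding F_cbox by (simp add: F_def)
  ultimately have "integral (cbox (vector [a, c]) (vector [b, d] :: real^2)) (\<lambda>v. f (G v)) =
      integral (cbox (a, c) (b, d)) f"
    by (simp add: integral_unique)
  also have "\<dots> = integral {a..b} (\<lambda>x. integral {c..d} (u x))"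
    using u by (subst integral_prod_continuous) (auto simp: f_def cbox_Pair_eq)
  finally show ?thesis by (simp add: f_def G_def)
qed

text \<open>
  As a map of the real plane, \<open>H\<close> has Jacobian determinant \<open>\<bar>H'\<bar>\<^sup>2\<close>, so for injective \<open>H\<close> the integral is
  the area of the image of the rectangle. The image lies in a square of side length \<open>2 M\<close>.
\<close>
lemma dirichlet_integral_le_area:
  assumes W: "open W" and holo: "H holomorphic_on W" and inj: "inj_on H W"
    and bd: "H ` W \<subseteq> cball 0 M"
    and sub: "\<And>x y. x \<in> {a..b} \<Longrightarrow> y \<in> {c..d} \<Longrightarrow> Complex x y \<in> W"
  shows "integral {a..b} (\<lambda>x. integral {c..d} (\<lambda>y. (cmod (deriv H (Complex x y)))\<^sup>2)) \<le> 4 * M\<^sup>2"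
proof (cases "W = {}")
  case True
  then have "integral {a..b} (\<lambda>x. integral {c..d} (\<lambda>y. (cmod (deriv H (Complex x y)))\<^sup>2)) = integral {a..b} (\<lambda>x. 0)"
    using sub by (intro integral_cong) (metis (no_types, lifting) empty_iff equals0I integral_empty)
  then show ?thesis by simp
next
  case False
  then obtain w0 where "w0 \<in> W" by blast
  then have "H w0 \<in> cball 0 M" using bd by blast
  then have M: "M \<ge> 0" using order_trans[OF norm_ge_zero[of "H w0"]] by simp
  define e :: "complex \<Rightarrow> real^2" where "e w = vector [Re w, Im w]" for w
  define l :: "real^2 \<Rightarrow> complex" where "l v = Complex (v $ 1) (v $ 2)" for v
  define S :: "(real^2) set" where "S = cbox (vector [a, c]) (vector [b, d])"
  have e: "bounded_linear e"
    unfolding linear_conv_bounded_linear[symmetric]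
    by (rule linearI) (auto simp: e_def vec_eq_iff forall_2)
  have l: "bounded_linear l"
    unfolding linear_conv_bounded_linear[symmetric]
    by (rule linearI) (auto simp: l_def complex_eq_iff)
  have S: "l v \<in> W" if "v \<in> S" for v
    using that sub by (auto simp: S_def l_def mem_box_cart forall_2)
  define G where "G v = e (H (l v))" for v
  define G' where "G' v h = e (deriv H (l v) * l h)" for v h
  have der: "(G has_derivative G' v) (at v within S)" if "v \<in> S" for v
  proof -
    have "(H has_field_derivative deriv H (l v)) (at (l v))"
      using holo W S[OF that] holomorphic_derivI by blast
    then have "(H has_derivative (*) (deriv H (l v))) (at (l v))"
      by (simp add: has_field_derivative_def)
    then have "((\<lambda>v. H (l v)) has_derivative (\<lambda>h. deriv H (l v) * l h)) (at v)"
      using has_derivative_compose[OF bounded_linear_imp_has_derivative[OF l]] by blast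
    then have "(G has_derivative G' v) (at v)"
      unfolding G_def G'_def using bounded_linear.has_derivative[OF e] by blast
    then show ?thesis by (rule has_derivative_at_withinI)
  qed
  have det: "\<bar>det (matrix (G' v))\<bar> = (cmod (deriv H (Complex (v $ 1) (v $ 2))))\<^sup>2" for v
    unfolding cmod_power2
    by (simp add: matrix_def det_2 G'_def e_def l_def axis_def power2_eq_square)
  have injG: "inj_on G S"
  proof (rule inj_onI)
    fix v w assume vw: "v \<in> S" "w \<in> S" "G v = G w"
    then have "H (l v) = H (l w)"
      by (simp add: G_def e_def vec_eq_iff forall_2 complex_eq_iff)
    then have "l v = l w" using inj S vw by (meson inj_onD)
    then show "v = w" by (simp add: l_def vec_eq_iff forall_2)
  qed
  have cont: "continuous_on ({a..b} \<times> {c..d}) (\<lambda>(x, y). (cmod (deriv H (Complex x y)))\<^sup>2)"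
  proof -
    have "continuous_on W (deriv H)"
      by (intro holomorphic_on_imp_continuous_on holomorphic_deriv holo W)
    then have "continuous_on ({a..b} \<times> {c..d}) (\<lambda>q. deriv H (Complex (fst q) (snd q)))"
      by (rule continuous_on_compose2) (use sub in \<open>auto intro!: continuous_intros simp: Complex_eq\<close>)
    then show ?thesis
      by (auto intro!: continuous_intros simp: case_prod_beta)
  qed
  have int: "(\<lambda>v. \<bar>det (matrix (G' v))\<bar>) integrable_on S"
    unfolding det S_def
  proof (intro integrable_continuous)
    show "continuous_on (cbox (vector [a, c]) (vector [b, d])) (\<lambda>v::real^2. (cmod (deriv H (Complex (v $ 1) (v $ 2))))\<^sup>2)"
      by (rule continuous_on_compose2[OF cont, where f = "\<lambda>v. (v $ 1, v $ 2)", simplified])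
         (auto intro!: continuous_intros simp: mem_box_cart forall_2)
  qed
  have Sm: "S \<in> sets lebesgue" by (simp add: S_def)
  have "integral {a..b} (\<lambda>x. integral {c..d} (\<lambda>y. (cmod (deriv H (Complex x y)))\<^sup>2)) =
      integral S (\<lambda>v. \<bar>det (matrix (G' v))\<bar>)"
    unfolding det S_def using integral_real2_eq_iterated[OF cont] by simp
  also have "\<dots> = measure lebesgue (G ` S)"
    using measure_differentiable_image_eq[OF Sm der injG int] by simp
  also have "\<dots> \<le> measure lebesgue (cbox (vector [-M, -M]) (vector [M, M] :: real^2))"
  proof (rule measure_mono_fmeasurable)
    show "G ` S \<subseteq> cbox (vector [- M, - M]) (vector [M, M])"
    proof clarify
      fix v assume "v \<in> S"
      then have "cmod (H (l v)) \<le> M" using S bd by (auto simp: image_subset_iff)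
      then show "G v \<in> cbox (vector [- M, - M]) (vector [M, M])"
        using abs_Re_le_cmod[of "H (l v)"] abs_Im_le_cmod[of "H (l v)"]
        by (auto simp: G_def e_def mem_box_cart forall_2)
    qed
    have "G ` S \<in> lmeasurable"
      using measurable_differentiable_image_eq[OF Sm der injG] int by blast
    then show "G ` S \<in> sets lebesgue" by (rule fmeasurableD)
  qed auto
  also have "\<dots> = 4 * M\<^sup>2"
  proof -
    have "cbox (vector [-M, -M]) (vector [M, M] :: real^2) \<noteq> {}"
      using M by (simp add: interval_ne_empty_cart(1) forall_2)
    then show ?thesis
      by (simp add: content_cbox_cart UNIV_2 power2_eq_square)
  qed
  finally show ?thesis .
qed

definition half_strip :: "real \<Rightarrow> complex set" where
  "half_strip X = {w. Re w < X \<and> \<bar>Im w\<bar> < pi / 2}"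

lemma open_half_strip: "open (half_strip X)"
  unfolding half_strip_def by (intro open_Collect_conj open_Collect_less continuous_intros)

text \<open>
  The integral of \<open>\<bar>H'\<bar>\<^sup>2\<close> over the half strip is finite. On a long rectangle, some vertical segment must
  therefore carry a small integral of \<open>\<bar>H'\<bar>\<^sup>2\<close>, and the Cauchy-Schwarz inequality turns this into the
  Hoelder estimate. Since \<open>H\<close> is not controlled on the two edges of the strip, the
  argument first uses segments that stay away from the edges, and then one abscissa that
  serves all of them, by compactness.
\<close>
lemma short_vertical_segment:
  assumes holo: "H holomorphic_on half_strip X" and inj: "inj_on H (half_strip X)"
    and bd: "H ` half_strip X \<subseteq> cball 0 M" and e: "e > 0"
  obtains x where "x < X"
    "\<And>s t. \<bar>s\<bar> < pi / 2 \<Longrightarrow> \<bar>t\<bar> < pi / 2 \<Longrightarrow> (cmod (H (Complex x s) - H (Complex x t)))\<^sup>2 \<le> e * \<bar>s - t\<bar>"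
proof -
  \<comment> \<open>a rectangle of length \<open>L\<close> is long enough: its integral would exceed \<open>4 M\<^sup>2\<close> if all segments carried more than \<open>e\<close>\<close>
  define L where "L = 4 * M\<^sup>2 / e + 1"
  have L: "L > 0" "e * L > 4 * M\<^sup>2"
    using e by (auto simp: L_def field_simps add_pos_nonneg)
  define J where "J = {X - 1 - L..X - 1}"
  define c where "c k = pi / 2 - pi / 2 / real (k + 2)" for k :: nat
  have c: "0 \<le> c k" "c k < pi / 2" for k
    by (auto simp: c_def field_simps)
  have c_mono: "c k \<le> c m" if "k \<le> m" for k m
    using that unfolding c_def by (intro diff_left_mono divide_left_mono) auto
  define u where "u x y = (cmod (deriv H (Complex x y)))\<^sup>2" for x y
  define I where "I k x = integral {-c k..c k} (u x)" for k x
  have cont_deriv: "continuous_on (half_strip X) (deriv H)"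
    by (intro holomorphic_on_imp_continuous_on holomorphic_deriv holo open_half_strip)
  have cont_u: "continuous_on ({..<X} \<times> {-(pi/2)<..<pi/2}) (\<lambda>(x, y). u x y)"
  proof -
    have "continuous_on ({..<X} \<times> {-(pi/2)<..<pi/2}) (\<lambda>q. deriv H (Complex (fst q) (snd q)))"
      by (rule continuous_on_compose2[OF cont_deriv])
         (auto intro!: continuous_intros simp: Complex_eq half_strip_def)
    then show ?thesis
      by (auto intro!: continuous_intros simp: case_prod_beta u_def)
  qed
  have cont_ux: "continuous_on {s..t} (u x)" if "x < X" "- pi / 2 < s" "t < pi / 2" for x s t
  proof -
    have "continuous_on {s..t} (\<lambda>y. (\<lambda>(x, y). u x y) (x, y))"
      by (rule continuous_on_compose2[OF cont_u]) (use that in \<open>auto intro!: continuous_intros\<close>)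
    then show ?thesis by simp
  qed
  have cont_I: "continuous_on J (I k)" for k
  proof -
    have "continuous_on (J \<times> cbox (- c k) (c k)) (\<lambda>(x, y). u x y)"
      by (rule continuous_on_subset[OF cont_u]) (use c[of k] L in \<open>auto simp: J_def\<close>)
    then show ?thesis
      unfolding I_def using integral_continuous_on_param[of J "- c k" "c k" u] by simp
  qed
  define E where "E k = {x \<in> J. I k x \<le> e}" for k
  have "E k \<noteq> {}" for k
  proof
    assume "E k = {}"
    then have big: "e \<le> I k x" if "x \<in> J" for x
      using that unfolding E_def by force
    have "e * L = integral J (\<lambda>x. e)"
      using L by (simp add: J_def)
    also have "\<dots> \<le> integral J (I k)"
      using big by (intro integral_le) (auto simp: J_def intro!: integrable_continuous_real cont_I[unfolded J_def])
    also have "\<dots> \<le> 4 * M\<^sup>2"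
      unfolding J_def I_def u_def
    proof (rule dirichlet_integral_le_area[OF open_half_strip holo inj bd])
      show "Complex x y \<in> half_strip X" if "x \<in> {X - 1 - L..X - 1}" "y \<in> {- c k..c k}" for x y
        using that c[of k] by (auto simp: half_strip_def)
    qed
    finally show False using L by simp
  qed
  moreover have "compact (E k)" for k
  proof -
    have "closedin (top_of_set J) (E k)"
      using continuous_closedin_preimage[OF cont_I[of k], of "{..e}"]
      by (simp add: E_def vimage_def Int_def)
    then show ?thesis
      using closedin_compact by (auto simp: J_def)
  qed
  moreover have "E m \<subseteq> E k" if "k \<le> m" for k m
  proof
    fix x assume x: "x \<in> E m"
    then have "x < X" using L by (auto simp: E_def J_def)
    then have "I k x \<le> I m x"
      unfolding I_def using c[of k] c[of m] c_mono[OF that]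
      by (intro integral_subset_le integrable_continuous_real cont_ux) (auto simp: u_def)
    then show "x \<in> E k" using x by (auto simp: E_def)
  qed
  ultimately have "\<Inter> (range E) \<noteq> {}"
    by (intro compact_nest)
  then obtain x where x: "\<And>k. x \<in> E k" by blast
  have xX: "x < X" using x[of 0] L by (auto simp: E_def J_def)
  have main: "(cmod (H (Complex x t) - H (Complex x s)))\<^sup>2 \<le> e * (t - s)"
    if st: "s \<le> t" "- pi / 2 < s" "t < pi / 2" for s t
  proof -
    define r where "r = min (pi / 2 - t) (pi / 2 + s)"
    have "r > 0" using st by (auto simp: r_def)
    obtain k :: nat where k: "real k > pi / 2 / r" using reals_Archimedean2 by blast
    then have "pi / 2 < r * real k" using \<open>r > 0\<close> by (simp add: field_simps)
    then have "pi / 2 / real (k + 2) < r"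
      using \<open>r > 0\<close> by (simp add: field_simps)
    then have ck: "- c k \<le> s" "t \<le> c k"
      by (auto simp: c_def r_def)
    have strip: "Complex x y \<in> half_strip X" if "y \<in> {s..t}" for y
      using that st xX by (auto simp: half_strip_def)
    have "((\<lambda>y. \<i> * deriv H (Complex x y)) has_integral H (Complex x t) - H (Complex x s)) {s..t}"
    proof (rule fundamental_theorem_of_calculus[OF st(1)])
      fix y assume y: "y \<in> {s..t}"
      have 1: "((\<lambda>y. Complex x y) has_vector_derivative \<i>) (at y within {s..t})"
        unfolding Complex_eq by (auto intro!: derivative_eq_intros simp: has_vector_derivative_def scaleR_conv_of_real)
      have 2: "(H has_field_derivative deriv H (Complex x y)) (at (Complex x y) within (\<lambda>y. Complex x y) ` {s..t})"
        using holomorphic_derivI[OF holo open_half_strip strip[OF y]] by (rule has_field_derivative_at_within)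
      show "((\<lambda>y. H (Complex x y)) has_vector_derivative \<i> * deriv H (Complex x y)) (at y within {s..t})"
        using field_vector_diff_chain_within[OF 1 2] by (simp add: o_def)
    qed
    then have "H (Complex x t) - H (Complex x s) = integral {s..t} (\<lambda>y. \<i> * deriv H (Complex x y))"
      by (intro integral_unique[symmetric])
    moreover have cd: "continuous_on {s..t} (\<lambda>y. deriv H (Complex x y))"
      by (rule continuous_on_compose2[OF cont_deriv])
         (use strip in \<open>auto intro!: continuous_intros simp: Complex_eq\<close>)
    ultimately have "cmod (H (Complex x t) - H (Complex x s)) \<le> integral {s..t} (\<lambda>y. cmod (deriv H (Complex x y)))"
      by (auto intro!: integral_norm_bound_integral integrable_continuous_real continuous_intros simp: norm_mult)
    then have "(cmod (H (Complex x t) - H (Complex x s)))\<^sup>2 \<le> (integral {s..t} (\<lambda>y. cmod (deriv H (Complex x y))))\<^sup>2"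
      by (intro power_mono) auto
    also have "\<dots> \<le> (t - s) * integral {s..t} (u x)"
      unfolding u_def by (intro integral_square_le st(1) continuous_intros cd)
    also have "\<dots> \<le> (t - s) * e"
    proof (rule mult_left_mono)
      have "integral {s..t} (u x) \<le> I k x"
        unfolding I_def using ck c[of k] st xX
        by (intro integral_subset_le integrable_continuous_real cont_ux) (auto simp: u_def)
      also have "\<dots> \<le> e" using x[of k] by (simp add: E_def)
      finally show "integral {s..t} (u x) \<le> e" .
    qed (use st in auto)
    finally show ?thesis by (simp add: mult.commute)
  qed
  show ?thesis
  proof (rule that[OF xX])
    fix s t assume "\<bar>s\<bar> < pi / 2" "\<bar>t\<bar> < pi / 2"
    then show "(cmod (H (Complex x s) - H (Complex x t)))\<^sup>2 \<le> e * \<bar>s - t\<bar>"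
      using main[of s t] main[of t s] by (cases "s \<le> t") (auto simp: norm_minus_commute)
  qed
qed

section \<open>Locally connected sphere boundaries\<close>

text \<open>
  The inverse of the Moebius map \<open>w \<mapsto> 1/(w - w0)\<close>, as a chart of the sphere without the point \<open>w0\<close>.
\<close>
definition sphere_chart :: "complex \<Rightarrow> complex \<Rightarrow> complex option" where
  "sphere_chart w0 v = (if v = 0 then None else Some (w0 + 1 / v))"

lemma inj_sphere_chart: "inj (sphere_chart w0)"
  by (rule injI) (auto simp: sphere_chart_def split: if_splits)

lemma range_sphere_chart: "range (sphere_chart w0) = - {Some w0}"
proof -
  have "x \<in> range (sphere_chart w0)" if "x \<noteq> Some w0" for x
  proof (cases x)
    case None
    then show ?thesis by (metis rangeI sphere_chart_def)
  next
    case (Some w)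
    then have "x = sphere_chart w0 (1 / (w - w0))"
      using that by (simp add: sphere_chart_def)
    then show ?thesis by blast
  qed
  then show ?thesis by (auto simp: sphere_chart_def split: if_splits)
qed

text \<open>
  At \<open>v = 0\<close>, continuity means that the preimage of a compact set of the plane stays away from 0:
  there \<open>w0 + 1/v\<close> is bounded.
\<close>
lemma continuous_map_sphere_chart: "continuous_map euclidean riemann_sphere (sphere_chart w0)"
proof -
  define j where "j v = w0 + 1 / v" for v :: complex
  have j: "continuous_on S j" if "0 \<notin> S" for S
    unfolding j_def using that by (auto intro!: continuous_intros)
  have "open (sphere_chart w0 -` U)" if U: "openin riemann_sphere U" for U
  proof -
    consider V where "open V" "U = Some ` V" | C where "compact C" "U = insert None (Some ` (- C))"
      using U unfolding riemann_sphere_def openin_Alexandroff_compactification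
      by (auto simp: Compl_eq_Diff_UNIV)
    then show ?thesis
    proof cases
      case 1
      then have "sphere_chart w0 -` U = (- {0}) \<inter> j -` V"
        by (auto simp: sphere_chart_def j_def split: if_splits)
      then show ?thesis
        using continuous_open_preimage[OF j _ 1(1), of "- {0}"] by auto
    next
      case 2
      obtain R where R: "R > 0" "\<And>w. w \<in> C \<Longrightarrow> cmod w \<le> R"
        using 2(1) compact_imp_bounded bounded_pos by metis
      define r where "r = 1 / (R + cmod w0)"
      have Rp: "R + cmod w0 > 0" using R(1) by (simp add: add_pos_nonneg)
      then have r: "r > 0" by (simp add: r_def)
      have far: "r \<le> cmod v" if "v \<noteq> 0" "j v \<in> C" for v
      proof -
        have "cmod (1 / v) \<le> cmod (j v) + cmod w0"
          unfolding j_def using norm_triangle_ineq4[of "w0 + 1 / v" w0] by simp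
        also have "\<dots> \<le> R + cmod w0" using R(2)[OF that(2)] by simp
        finally show ?thesis
          using that(1) Rp by (simp add: r_def norm_divide field_simps)
      qed
      have "- (sphere_chart w0 -` U) = {v. r \<le> cmod v} \<inter> j -` C"
        using far r unfolding 2(2)
        by (auto simp: sphere_chart_def j_def inj_image_mem_iff split: if_splits)
      moreover have "closed ({v. r \<le> cmod v} \<inter> j -` C)"
        using r by (intro continuous_closed_preimage j compact_imp_closed 2(1) closed_Collect_le continuous_intros) auto
      ultimately show ?thesis
        by (metis closed_def double_compl)
    qed
  qed
  then show ?thesis
    by (auto simp: continuous_map_def riemann_sphere_def vimage_def notin_range_Some)
qed

lemma Hausdorff_riemann_sphere: "Hausdorff_space riemann_sphere"
  unfolding riemann_sphere_def
  by (simp add: Hausdorff_space_Alexandroff_compactification locally_compact_space_euclidean)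

text \<open>
  The domain contains a neighbourhood of \<open>w0\<close>, the only point outside the chart, so the boundary
  lies in a bounded part of the chart. A continuous injection of a compact space into the Hausdorff
  sphere is an embedding, and local connectedness passes to the planar set.
\<close>
lemma sphere_boundary_in_chart:
  assumes E: "open E" "w0 \<in> E"
  defines "K \<equiv> sphere_chart w0 -` sphere_boundary E"
    and "\<Omega> \<equiv> sphere_chart w0 -` Some ` E"
  shows "open \<Omega>" "compact K" "K \<inter> \<Omega> = {}" "frontier \<Omega> \<subseteq> K"
    "locally_connected_space (subtopology riemann_sphere (sphere_boundary E)) \<Longrightarrow>
      locally_connected_space (top_of_set K)"
proof -
  let ?N = "sphere_chart w0"
  have opE: "openin riemann_sphere (Some ` E)"
    using E(1) by (simp add: riemann_sphere_def)
  have bd: "sphere_boundary E = riemann_sphere closure_of (Some ` E) - Some ` E"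
    unfolding sphere_boundary_def using opE by (simp add: frontier_of_def interior_of_openin)
  show op: "open \<Omega>"
    using continuous_map_sphere_chart[of w0] opE
    by (auto simp: continuous_map_def \<Omega>_def vimage_def)
  show disj: "K \<inter> \<Omega> = {}"
    by (auto simp: K_def \<Omega>_def bd)
  have "closedin riemann_sphere (sphere_boundary E)"
    by (simp add: sphere_boundary_def closedin_frontier_of)
  then have "closed K"
    using continuous_map_sphere_chart[of w0]
    by (simp add: continuous_map_closedin K_def vimage_def)
  moreover have "bounded K"
  proof -
    obtain r where r: "r > 0" "ball w0 r \<subseteq> E"
      using E by (meson open_contains_ball)
    have "cmod v \<le> 1 / r" if "v \<in> K" for v
    proof (rule ccontr)
      assume v: "\<not> cmod v \<le> 1 / r"
      then have "v \<noteq> 0" using r(1) by auto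
      moreover have "w0 + 1 / v \<in> ball w0 r"
        using v r(1) \<open>v \<noteq> 0\<close> by (simp add: dist_norm norm_divide field_simps)
      ultimately have "v \<in> \<Omega>"
        using r(2) by (auto simp: \<Omega>_def sphere_chart_def)
      then show False using disj that by blast
    qed
    then show ?thesis by (meson boundedI)
  qed
  ultimately show comp: "compact K"
    by (simp add: compact_eq_bounded_closed)
  show "frontier \<Omega> \<subseteq> K"
  proof
    fix v assume "v \<in> frontier \<Omega>"
    then have v: "v \<in> closure \<Omega>" "v \<notin> \<Omega>"
      using op by (auto simp: frontier_def interior_open)
    have "?N v \<in> riemann_sphere closure_of (?N ` \<Omega>)"
      using continuous_map_image_closure_subset[OF continuous_map_sphere_chart[of w0], of \<Omega>] v(1)
      by auto
    moreover have "?N ` \<Omega> \<subseteq> Some ` E"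
      by (auto simp: \<Omega>_def)
    ultimately have "?N v \<in> riemann_sphere closure_of (Some ` E)"
      by (meson closure_of_mono subsetD)
    then show "v \<in> K"
      using v(2) by (auto simp: K_def \<Omega>_def bd)
  qed
  have img: "?N ` K = sphere_boundary E"
  proof -
    have "Some w0 \<notin> sphere_boundary E"
      using E(2) by (auto simp: bd)
    then show ?thesis
      unfolding K_def using range_sphere_chart[of w0] by (auto simp: image_vimage_eq)
  qed
  have "homeomorphic_map (top_of_set K) (subtopology riemann_sphere (sphere_boundary E)) ?N"
  proof (rule continuous_imp_homeomorphic_map)
    show "continuous_map (top_of_set K) (subtopology riemann_sphere (sphere_boundary E)) ?N"
      using continuous_map_from_subtopology[OF continuous_map_sphere_chart] img
      by (auto simp: continuous_map_in_subtopology)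
    show "compact_space (top_of_set K)"
      using comp by (simp add: compact_space_subtopology)
    show "Hausdorff_space (subtopology riemann_sphere (sphere_boundary E))"
      by (simp add: Hausdorff_riemann_sphere Hausdorff_space_subtopology)
    show "?N ` topspace (top_of_set K) = topspace (subtopology riemann_sphere (sphere_boundary E))"
      using img by (auto simp: riemann_sphere_def sphere_boundary_def frontier_of_def in_closure_of)
    show "inj_on ?N (topspace (top_of_set K))"
      using inj_sphere_chart by (simp add: inj_on_def)
  qed
  then show "locally_connected_space (top_of_set K)"
    if "locally_connected_space (subtopology riemann_sphere (sphere_boundary E))"
    using that homeomorphic_locally_connected_space homeomorphic_map_imp_homeomorphic_space by blast
qed

text \<open>
  Compactness makes local connectedness uniform: nearby points lie in a common small connected
  piece by Lebesgue's covering lemma, and closing up the piece makes it compact.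
\<close>
lemma small_continua_between_nearby_points:
  fixes K :: "'a::metric_space set"
  assumes K: "compact K" and lc: "locally_connected_space (top_of_set K)" and e: "e > 0"
  obtains d where "d > 0"
    "\<And>a b. a \<in> K \<Longrightarrow> b \<in> K \<Longrightarrow> dist a b < d \<Longrightarrow>
      \<exists>B. compact B \<and> connected B \<and> a \<in> B \<and> b \<in> B \<and> B \<subseteq> K \<and> B \<subseteq> cball a e"
proof -
  define \<C> where "\<C> = {T. open T \<and> connected (K \<inter> T) \<and> (\<exists>x. K \<inter> T \<subseteq> cball x (e / 2))}"
  have ne: "\<C> \<noteq> {}"
    unfolding \<C>_def by (rule ex_in_conv[THEN iffD1], rule exI[of _ "{}"]) auto
  have cov: "K \<subseteq> \<Union>\<C>"
  proof
    fix x assume x: "x \<in> K"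
    have "openin (top_of_set K) (K \<inter> ball x (e / 2))" "x \<in> K \<inter> ball x (e / 2)"
      using x e by (auto simp: openin_open_Int)
    then obtain U where U: "openin (top_of_set K) U" "connectedin (top_of_set K) U" "x \<in> U"
        "U \<subseteq> K \<inter> ball x (e / 2)"
      using lc unfolding locally_connected_space by meson
    obtain T where T: "open T" "U = K \<inter> T"
      using U(1) by (auto simp: openin_open)
    have "T \<in> \<C>"
      unfolding \<C>_def using T U by (auto simp: connectedin_subtopology intro!: exI[of _ x])
    then show "x \<in> \<Union>\<C>" using T U by blast
  qed
  obtain d where d: "d > 0" "\<And>T. T \<subseteq> K \<Longrightarrow> diameter T < d \<Longrightarrow> \<exists>B\<in>\<C>. T \<subseteq> B"
    using Lebesgue_number_lemma[OF K ne cov] by (auto simp: \<C>_def)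
  show ?thesis
  proof (rule that[OF d(1)])
    fix a b assume ab: "a \<in> K" "b \<in> K" "dist a b < d"
    have "diameter {a, b} < d"
      using ab(3) d(1) by (simp add: diameter_def dist_commute cSup_eq_Max)
    then obtain T where T: "T \<in> \<C>" "a \<in> T" "b \<in> T"
      using d(2)[of "{a, b}"] ab by auto
    then obtain x where x: "connected (K \<inter> T)" "K \<inter> T \<subseteq> cball x (e / 2)"
      by (auto simp: \<C>_def)
    define B where "B = closure (K \<inter> T)"
    have BK: "B \<subseteq> K"
      unfolding B_def using K by (meson closure_minimal compact_imp_closed inf_le1)
    have Bx: "B \<subseteq> cball x (e / 2)"
      unfolding B_def using x(2) by (meson closed_cball closure_minimal)
    have "compact B"
      using BK K B_def by (metis closed_closure compact_Int_closed inf.absorb_iff2 inf_commute)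
    moreover have "connected B"
      unfolding B_def using x(1) by (rule connected_imp_connected_closure)
    moreover have aB: "a \<in> B" "b \<in> B"
      unfolding B_def using ab T closure_subset by fastforce+
    moreover have "B \<subseteq> cball a e"
    proof
      fix y assume "y \<in> B"
      then have "dist x y \<le> e / 2" "dist x a \<le> e / 2"
        using Bx aB by auto
      then show "y \<in> cball a e"
        using dist_triangle[of a y x] by (simp add: dist_commute)
    qed
    ultimately show "\<exists>B. compact B \<and> connected B \<and> a \<in> B \<and> b \<in> B \<and> B \<subseteq> K \<and> B \<subseteq> cball a e"
      using BK by blast
  qed
qed

section \<open>Boundary limits by Caratheodory's crosscut argument\<close>

text \<open>
  For \<open>\<bar>\<zeta>\<bar> = 1\<close> this maps the strip \<open>\<bar>Im w\<bar> < pi/2\<close> conformally onto the unit disk, with \<open>Re w \<rightarrow> -\<infinity>\<close> at the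
  boundary point \<open>\<zeta>\<close>. The vertical segments are mapped to circular crosscuts around \<open>\<zeta>\<close>, which are the
  level lines of the function \<open>apollonius\<close> below.
\<close>
definition strip_map :: "complex \<Rightarrow> complex \<Rightarrow> complex" where
  "strip_map \<zeta> w = \<zeta> * (1 - exp w) / (1 + exp w)"

definition apollonius :: "complex \<Rightarrow> complex \<Rightarrow> real" where
  "apollonius \<zeta> z = cmod (\<zeta> - z) / cmod (\<zeta> + z)"

lemma one_plus_exp_nonzero:
  assumes "\<bar>Im w\<bar> \<le> pi / 2"
  shows "1 + exp w \<noteq> 0"
proof
  assume "1 + exp w = 0"
  then have "Re (1 + exp w) = 0" by simp
  moreover have "cos (Im w) \<ge> 0"
    using assms by (intro cos_ge_zero) auto
  ultimately show False
    by (simp add: Re_exp add_nonneg_eq_0_iff)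
qed

text \<open>
  The right half-plane is the set of points closer to 1 than to -1; with \<open>a = 1\<close> this links the
  exponential of the strip, a half-plane, to the unit disk.
\<close>
lemma cmod_diff_less_cmod_sum_iff:
  "cmod (a - b) < cmod (a + b) \<longleftrightarrow> 0 < Re (a * cnj b)"
proof -
  have "cmod (a - b) < cmod (a + b) \<longleftrightarrow> (cmod (a - b))\<^sup>2 < (cmod (a + b))\<^sup>2"
    by (auto intro: power_strict_mono power2_less_imp_less)
  also have "(cmod (a + b))\<^sup>2 = (cmod (a - b))\<^sup>2 + 4 * Re (a * cnj b)"
    unfolding cmod_power2 by (simp add: power2_eq_square algebra_simps)
  also have "(cmod (a - b))\<^sup>2 < \<dots> \<longleftrightarrow> 0 < Re (a * cnj b)"
    by linarith
  finally show ?thesis .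
qed

lemma strip_map_in_ball:
  assumes "cmod \<zeta> = 1" "\<bar>Im w\<bar> < pi / 2"
  shows "strip_map \<zeta> w \<in> ball 0 1"
proof -
  have "cos (Im w) > 0"
    using assms(2) by (intro cos_gt_zero_pi) auto
  then have "0 < Re (1 * cnj (exp w))"
    by (simp add: Re_exp)
  then have "cmod (1 - exp w) < cmod (1 + exp w)"
    unfolding cmod_diff_less_cmod_sum_iff .
  then show ?thesis
    using assms by (simp add: strip_map_def norm_mult norm_divide divide_less_eq)
qed

lemma strip_map_edge:
  assumes "cmod \<zeta> = 1" "\<bar>Im w\<bar> = pi / 2"
  shows "cmod (strip_map \<zeta> w) = 1"
proof -
  have "Im w = pi / 2 \<or> Im w = - (pi / 2)"
    using assms(2) by linarith
  then have "cos (Im w) = 0"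
    by (metis cos_minus cos_pi_half)
  then have "Re (exp w) = 0"
    by (simp add: Re_exp)
  then have "cmod (1 - exp w) = cmod (1 + exp w)"
    by (simp add: cmod_def)
  then show ?thesis
    using assms one_plus_exp_nonzero[of w] by (simp add: strip_map_def norm_mult norm_divide)
qed

lemma continuous_on_strip_map:
  "continuous_on {w. \<bar>Im w\<bar> \<le> pi / 2} (strip_map \<zeta>)"
  unfolding strip_map_def using one_plus_exp_nonzero by (auto intro!: continuous_intros)

lemma strip_map_inverse:
  assumes "\<zeta> \<noteq> 0" "\<bar>Im w\<bar> < pi / 2"
  shows "(\<zeta> - strip_map \<zeta> w) / (\<zeta> + strip_map \<zeta> w) = exp w"
proof -
  have nz: "1 + exp w \<noteq> 0"
    using assms(2) by (intro one_plus_exp_nonzero) auto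
  have "\<zeta> - strip_map \<zeta> w = 2 * \<zeta> * exp w / (1 + exp w)" "\<zeta> + strip_map \<zeta> w = 2 * \<zeta> / (1 + exp w)"
    using nz by (simp_all add: strip_map_def field_simps)
  then show ?thesis
    using nz assms(1) by simp
qed

lemma apollonius_strip_map:
  assumes "\<zeta> \<noteq> 0" "\<bar>Im w\<bar> < pi / 2"
  shows "apollonius \<zeta> (strip_map \<zeta> w) = exp (Re w)"
  using strip_map_inverse[OF assms] unfolding apollonius_def
  by (metis norm_divide norm_exp_eq_Re)

lemma inj_on_strip_map:
  assumes "\<zeta> \<noteq> 0"
  shows "inj_on (strip_map \<zeta>) {w. \<bar>Im w\<bar> < pi / 2}"
proof (rule inj_on_inverseI)
  fix w assume w: "w \<in> {w. \<bar>Im w\<bar> < pi / 2}"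
  then show "Ln ((\<zeta> - strip_map \<zeta> w) / (\<zeta> + strip_map \<zeta> w)) = w"
    using strip_map_inverse[OF assms, of w] by (auto intro!: Ln_exp)
qed

lemma strip_map_surj:
  assumes "cmod \<zeta> = 1" "z \<in> ball 0 1"
  obtains w where "\<bar>Im w\<bar> < pi / 2" "z = strip_map \<zeta> w"
proof -
  have ne: "\<zeta> + z \<noteq> 0" "\<zeta> - z \<noteq> 0" "\<zeta> \<noteq> 0"
    using assms by (auto simp: add_eq_0_iff)
  define u where "u = (\<zeta> - z) / (\<zeta> + z)"
  have u: "u \<noteq> 0" "1 + u = 2 * \<zeta> / (\<zeta> + z)" "1 - u = 2 * z / (\<zeta> + z)"
    using ne by (auto simp: u_def field_simps)
  have zu: "z = \<zeta> * (1 - u) / (1 + u)" and nz: "1 + u \<noteq> 0"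
    unfolding u using ne by simp_all
  have "cmod (1 - u) < cmod (1 + u)"
    using u ne assms by (simp add: norm_divide norm_mult divide_strict_right_mono)
  then have "Re u > 0"
    unfolding cmod_diff_less_cmod_sum_iff by simp
  then have "\<bar>Im (Ln u)\<bar> < pi / 2"
    using Re_Ln_pos_lt[OF u(1)] by blast
  moreover have "z = strip_map \<zeta> (Ln u)"
    using zu u(1) by (simp add: strip_map_def)
  ultimately show ?thesis using that by blast
qed

lemma continuous_on_apollonius:
  assumes "cmod \<zeta> = 1"
  shows "continuous_on (ball 0 1) (apollonius \<zeta>)"
proof -
  have "\<zeta> + z \<noteq> 0" if "z \<in> ball 0 1" for z
    using that assms by (auto simp: add_eq_0_iff)
  then show ?thesis
    unfolding apollonius_def by (auto intro!: continuous_intros)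
qed

lemma apollonius_small_near:
  assumes "cmod \<zeta> = 1" "r > 0" "z \<in> ball 0 1" "dist \<zeta> z < min 1 r"
  shows "apollonius \<zeta> z < r"
proof -
  have 1: "cmod (\<zeta> - z) < 1" "cmod (\<zeta> - z) < r"
    using assms(4) by (auto simp: dist_norm)
  have "2 = cmod ((\<zeta> - z) + (\<zeta> + z))"
    using assms(1) by (simp add: norm_mult flip: mult_2)
  also have "\<dots> \<le> cmod (\<zeta> - z) + cmod (\<zeta> + z)"
    by (rule norm_triangle_ineq)
  finally have 2: "cmod (\<zeta> + z) \<ge> 1" using 1 by simp
  then have "apollonius \<zeta> z \<le> cmod (\<zeta> - z)"
    unfolding apollonius_def by (auto simp: divide_le_eq intro: order_trans[OF _ mult_left_mono[OF 2]])
  then show ?thesis using 1 by simp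
qed

text \<open>
  The function \<open>h\<close> stands for \<open>1/(f z - f p)\<close>, and \<open>K\<close> for the boundary of its image \<open>\<Omega>\<close>. Let \<open>S\<close> be the closure of
  the image of a short crosscut around \<open>\<zeta>\<close>, joined with a small continuum \<open>B\<close> in \<open>K\<close> through its two ends.
  Suppose that a point \<open>h z\<close> beyond the crosscut lies outside a small disk around \<open>S\<close>, and take \<open>h z0\<close> outside
  that disk on the other side of the crosscut, near the pole. The two points are separated neither
  by \<open>S\<close>, which lies in the disk, nor by \<open>K\<close>, since both are in \<open>\<Omega>\<close>. As \<open>S \<inter> K = B\<close> is
  connected, Janiszewski's theorem connects them outside \<open>S \<union> K\<close>, thus in \<open>\<Omega>\<close> without crossing the
  crosscut. This is impossible, since the crosscut separates \<open>z\<close> from \<open>z0\<close> in the disk.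
\<close>
lemma oscillation_small_near_boundary_point:
  fixes h :: "complex \<Rightarrow> complex"
  assumes p: "p \<in> ball 0 1" and \<zeta>: "cmod \<zeta> = 1"
    and holo: "h holomorphic_on ball 0 1 - {p}" and inj: "inj_on h (ball 0 1 - {p})"
    and bdd: "\<And>r. r > 0 \<Longrightarrow> bounded (h ` (ball 0 1 - ball p r))"
    and unbdd: "\<And>r M. r > 0 \<Longrightarrow> \<exists>z\<in>ball 0 1 \<inter> ball p r - {p}. M < cmod (h z)"
    and K: "compact K" "locally_connected_space (top_of_set K)"
    and fr: "frontier (h ` (ball 0 1 - {p})) \<subseteq> K" "K \<inter> h ` (ball 0 1 - {p}) = {}"
    and e: "e > 0"
  shows "\<exists>d>0. \<forall>z w. z \<in> ball 0 1 \<and> w \<in> ball 0 1 \<and> dist \<zeta> z < d \<and> dist \<zeta> w < d \<longrightarrow> dist (h z) (h w) \<le> e"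
proof -
  define D where "D = ball (0::complex) 1 - {p}"
  define \<Omega> where "\<Omega> = h ` D"
  define q where "q = apollonius \<zeta>"
  define T where "T = strip_map \<zeta>"
  have \<zeta>0: "\<zeta> \<noteq> 0" using \<zeta> by auto
  have opD: "open D" by (simp add: D_def open_delete)
  have conD: "connected D"
    unfolding D_def by (rule connected_open_delete) auto
  have holoD: "h holomorphic_on D" and injD: "inj_on h D"
    using holo inj by (simp_all add: D_def)
  have contD: "continuous_on D h" using holoD by (rule holomorphic_on_imp_continuous_on)
  obtain g where g: "homeomorphism D \<Omega> h g"
    using invariance_of_domain_homeomorphism[OF opD contD _ injD] by (auto simp: \<Omega>_def)
  have gh: "g (h z) = z" if "z \<in> D" for z
    using homeomorphism_apply1[OF g that] .
  have hg: "h (g v) = v" "g v \<in> D" if "v \<in> \<Omega>" for v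
    using homeomorphism_apply2[OF g that] g that unfolding homeomorphism_def by auto
  have contg: "continuous_on \<Omega> g"
    using g by (rule homeomorphism_cont2)
  have op\<Omega>: "open \<Omega>"
    unfolding \<Omega>_def using invariance_of_domain[OF contD opD injD] .
  have con\<Omega>: "connected \<Omega>"
    unfolding \<Omega>_def using connected_continuous_image[OF contD conD] .
  have K\<Omega>: "frontier \<Omega> \<subseteq> K" "K \<inter> \<Omega> = {}"
    using fr by (simp_all add: D_def \<Omega>_def)
  have contq: "continuous_on (ball 0 1) q"
    unfolding q_def by (rule continuous_on_apollonius[OF \<zeta>])
  have qp: "q p > 0"
  proof -
    have "\<zeta> + p \<noteq> 0" "\<zeta> - p \<noteq> 0" using p \<zeta> by (auto simp: add_eq_0_iff)
    then show ?thesis by (simp add: q_def apollonius_def)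
  qed
  \<comment> \<open>the crosscuts will have level below \<open>q p / 2\<close>, which keeps them away from the pole, where \<open>h\<close> is unbounded\<close>
  obtain r where r: "r > 0" "\<And>z. z \<in> ball 0 1 \<inter> ball p r \<Longrightarrow> q z > q p / 2"
  proof -
    have "continuous (at p within ball 0 1) q"
      using contq p by (simp add: continuous_on_eq_continuous_within)
    then obtain r where "r > 0" "\<And>z. z \<in> ball 0 1 \<Longrightarrow> dist z p < r \<Longrightarrow> dist (q z) (q p) < q p / 2"
      unfolding continuous_within_eps_delta using qp by (metis half_gt_zero)
    then show ?thesis
      using that[of r] by (force simp: dist_real_def abs_if dist_commute split: if_splits)
  qed
  define X where "X = ln (q p / 2)"
  have expX: "exp X = q p / 2" using qp by (simp add: X_def)
  have T_in: "T w \<in> D - ball p r" "T w \<in> ball 0 1" if "w \<in> half_strip X" for w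
  proof -
    have im: "\<bar>Im w\<bar> < pi / 2" and re: "Re w < X" using that by (auto simp: half_strip_def)
    show 1: "T w \<in> ball 0 1"
      unfolding T_def by (rule strip_map_in_ball[OF \<zeta> im])
    have "q (T w) < q p / 2"
      unfolding q_def T_def apollonius_strip_map[OF \<zeta>0 im] using re expX by (metis exp_less_cancel_iff q_def)
    then show "T w \<in> D - ball p r"
      using 1 r(2)[of "T w"] r(1) by (auto simp: D_def)
  qed
  define H where "H w = h (T w)" for w
  have holoH: "H holomorphic_on half_strip X"
  proof -
    have "T holomorphic_on half_strip X"
      unfolding T_def strip_map_def using one_plus_exp_nonzero
      by (intro holomorphic_intros) (auto simp: half_strip_def)
    then show ?thesis
      unfolding H_def using holomorphic_on_compose_gen[OF _ holoD, of T "half_strip X"] T_in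
      by (auto simp: o_def)
  qed
  have injH: "inj_on H (half_strip X)"
  proof (rule inj_onI)
    fix v w assume vw: "v \<in> half_strip X" "w \<in> half_strip X" "H v = H w"
    then have "T v = T w"
      unfolding H_def using T_in injD by (meson DiffD1 inj_onD)
    then show "v = w"
      using vw inj_on_strip_map[OF \<zeta>0] by (auto simp: T_def half_strip_def inj_on_def)
  qed
  obtain M where M: "\<And>z. z \<in> ball 0 1 - ball p r \<Longrightarrow> cmod (h z) \<le> M"
    using bdd[OF r(1)] by (force simp: bounded_iff)
  have bdH: "H ` half_strip X \<subseteq> cball 0 M"
    using T_in M unfolding H_def D_def by (auto simp: image_subset_iff)
  obtain d where d: "d > 0" and small: "\<And>a b. a \<in> K \<Longrightarrow> b \<in> K \<Longrightarrow> dist a b < d \<Longrightarrow>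
      \<exists>B. compact B \<and> connected B \<and> a \<in> B \<and> b \<in> B \<and> B \<subseteq> K \<and> B \<subseteq> cball a (e / 4)"
    using small_continua_between_nearby_points[OF K, of "e / 4"] e by (metis divide_pos_pos zero_less_numeral)
  define m where "m = min (d / 3) (e / 4)"
  have m: "m > 0" "2 * m < d" "m \<le> e / 4" using d e by (auto simp: m_def)
  define \<eta> where "\<eta> = m\<^sup>2 / pi"
  have \<eta>: "\<eta> > 0" using m by (simp add: \<eta>_def)
  obtain x where x: "x < X" and seg: "\<And>s t. \<bar>s\<bar> < pi / 2 \<Longrightarrow> \<bar>t\<bar> < pi / 2 \<Longrightarrow>
      (cmod (H (Complex x s) - H (Complex x t)))\<^sup>2 \<le> \<eta> * \<bar>s - t\<bar>"
    using short_vertical_segment[OF holoH injH bdH \<eta>] by blast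
  define I where "I = {- (pi/2)<..<pi/2}"
  have I_iff: "t \<in> I \<longleftrightarrow> \<bar>t\<bar> < pi / 2" for t
    unfolding I_def greaterThanLessThan_iff by linarith
  define c where "c t = H (Complex x t)" for t
  have clI: "closure I = {- (pi/2)..pi/2}"
    by (simp add: I_def)
  have in_strip: "Complex x t \<in> half_strip X" if "t \<in> I" for t
    using that x by (auto simp: I_def half_strip_def)
  have c\<Omega>: "c t \<in> \<Omega>" if "t \<in> I" for t
    using T_in[OF in_strip[OF that]] by (auto simp: c_def H_def \<Omega>_def)
  \<comment> \<open>the Hoelder estimate lets the image curve be extended to its two ends\<close>
  have c_unif: "uniformly_continuous_on I c"
    unfolding uniformly_continuous_on_def
  proof (intro allI impI)
    fix \<epsilon> :: real assume "\<epsilon> > 0"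
    show "\<exists>\<delta>>0. \<forall>s\<in>I. \<forall>t\<in>I. dist t s < \<delta> \<longrightarrow> dist (c t) (c s) < \<epsilon>"
    proof (intro exI[of _ "\<epsilon>\<^sup>2 / \<eta>"] conjI ballI impI)
      fix s t assume st: "s \<in> I" "t \<in> I" "dist t s < \<epsilon>\<^sup>2 / \<eta>"
      have "(dist (c t) (c s))\<^sup>2 \<le> \<eta> * \<bar>t - s\<bar>"
        using seg[of t s] st(1,2) unfolding I_iff c_def dist_norm by blast
      also have "\<dots> < \<epsilon>\<^sup>2"
        using st(3) \<eta> by (simp add: dist_real_def field_simps)
      finally show "dist (c t) (c s) < \<epsilon>"
        by (rule power2_less_imp_less) (use \<open>\<epsilon> > 0\<close> in simp)
    qed (use \<open>\<epsilon> > 0\<close> \<eta> in auto)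
  qed
  obtain C where C: "uniformly_continuous_on (closure I) C" "\<And>t. t \<in> I \<Longrightarrow> c t = C t"
    using uniformly_continuous_on_extension_on_closure[OF c_unif] by metis
  have contC: "continuous_on {- (pi/2)..pi/2} C"
    using C(1) clI uniformly_continuous_imp_continuous by metis
  have C_ball: "C t \<in> cball (c 0) m" if "t \<in> {- (pi/2)..pi/2}" for t
  proof -
    have "C ` closure I \<subseteq> cball (c 0) m"
    proof (rule image_closure_subset)
      show "C ` I \<subseteq> cball (c 0) m"
      proof (clarsimp simp flip: C(2))
        fix t assume t: "t \<in> I"
        have "(dist (c 0) (c t))\<^sup>2 \<le> \<eta> * \<bar>0 - t\<bar>"
          using seg[of 0 t] t unfolding I_iff c_def dist_norm by simp
        also have "\<dots> \<le> \<eta> * pi"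
          using t \<eta> by (intro mult_left_mono) (auto simp: I_def)
        also have "\<dots> = m\<^sup>2" by (simp add: \<eta>_def)
        finally show "dist (c 0) (c t) \<le> m"
          by (rule power2_le_imp_le) (use m in simp)
      qed
    qed (simp_all only: clI contC closed_cball)
    then show ?thesis using that unfolding clI by blast
  qed
  \<comment> \<open>an end inside \<open>\<Omega>\<close> would have its preimage at the end of the crosscut, on the unit circle\<close>
  have ends: "C t \<in> K" if t: "t = - (pi/2) \<or> t = pi/2" for t
  proof -
    have tI: "t \<in> closure I" "t \<notin> I"
      using t pi_gt_zero unfolding clI I_iff atLeastAtMost_iff by linarith+
    then have nb: "at t within I \<noteq> bot"
      by (simp add: trivial_limit_within islimpt_in_closure)
    have evI: "\<forall>\<^sub>F s in at t within I. P s" if "\<And>s. s \<in> I \<Longrightarrow> P s" for P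
      unfolding eventually_at using that by (intro exI[of _ 1]) auto
    have lim: "(c \<longlongrightarrow> C t) (at t within I)"
    proof -
      have "(C \<longlongrightarrow> C t) (at t within I)"
        using contC tI(1) clI closure_subset[of I] unfolding continuous_on_def by (metis tendsto_within_subset)
      then show ?thesis
        by (rule Lim_transform_eventually) (rule evI, simp add: C(2))
    qed
    have "C t \<in> closure \<Omega>"
      by (rule Lim_in_closed_set[OF _ _ nb lim]) (use c\<Omega> closure_subset in \<open>auto intro!: evI\<close>)
    moreover have "C t \<notin> \<Omega>"
    proof
      assume C\<Omega>: "C t \<in> \<Omega>"
      have "((\<lambda>s. g (c s)) \<longlongrightarrow> g (C t)) (at t within I)"
        by (rule continuous_on_tendsto_compose[OF contg lim C\<Omega>]) (use c\<Omega> in \<open>auto intro!: evI\<close>)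
      then have l1: "((\<lambda>s. T (Complex x s)) \<longlongrightarrow> g (C t)) (at t within I)"
      proof (rule Lim_transform_eventually)
        have "g (c s) = T (Complex x s)" if "s \<in> I" for s
          unfolding c_def H_def using T_in[OF in_strip[OF that]] gh by blast
        then show "\<forall>\<^sub>F s in at t within I. g (c s) = T (Complex x s)"
          by (rule evI)
      qed
      have "continuous_on {- (pi/2)..pi/2} (\<lambda>s. T (Complex x s))"
        unfolding T_def
        by (rule continuous_on_compose2[OF continuous_on_strip_map])
           (auto intro!: continuous_intros simp: Complex_eq)
      then have l2: "((\<lambda>s. T (Complex x s)) \<longlongrightarrow> T (Complex x t)) (at t within I)"
        using tI(1) clI closure_subset[of I] unfolding continuous_on_def by (metis (no_types, lifting) tendsto_within_subset)
      have "g (C t) = T (Complex x t)"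
        using tendsto_unique[OF nb l1 l2] .
      moreover have "cmod (T (Complex x t)) = 1"
      proof -
        have "\<bar>t\<bar> = pi / 2" using t pi_gt_zero by linarith
        then show ?thesis unfolding T_def by (intro strip_map_edge[OF \<zeta>]) simp
      qed
      moreover have "g (C t) \<in> D" using hg C\<Omega> by blast
      ultimately show False by (auto simp: D_def)
    qed
    ultimately have "C t \<in> frontier \<Omega>"
      using op\<Omega> by (simp add: frontier_def interior_open)
    then show ?thesis using K\<Omega> by blast
  qed
  define a where "a = C (- (pi/2))"
  define b where "b = C (pi/2)"
  have ab: "a \<in> K" "b \<in> K" using ends by (auto simp: a_def b_def)
  have ab_ball: "dist (c 0) a \<le> m" "dist (c 0) b \<le> m"
    using C_ball[of "- (pi/2)"] C_ball[of "pi/2"] by (auto simp: a_def b_def)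
  then have "dist a b < d"
    using dist_triangle3[of a b "c 0"] m by simp
  then obtain B where B: "compact B" "connected B" "a \<in> B" "b \<in> B" "B \<subseteq> K" "B \<subseteq> cball a (e / 4)"
    using small ab by blast
  define S where "S = C ` {- (pi/2)..pi/2} \<union> B"
  define R where "R = m + e / 4"
  have SR: "S \<subseteq> cball (c 0) R"
  proof -
    have "B \<subseteq> cball (c 0) R"
    proof
      fix y assume "y \<in> B"
      then have "dist a y \<le> e / 4" using B by auto
      then show "y \<in> cball (c 0) R"
        using ab_ball dist_triangle[of "c 0" y a] by (simp add: R_def)
    qed
    moreover have "C ` {- (pi/2)..pi/2} \<subseteq> cball (c 0) R"
      using C_ball e by (force simp: R_def)
    ultimately show ?thesis by (auto simp: S_def)
  qed
  have S_cases: "y \<in> c ` I \<or> y \<in> B" if "y \<in> S" for y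
  proof -
    have "{- (pi/2)..pi/2} = insert (- (pi/2)) (insert (pi/2) I)"
      by (auto simp: I_def)
    then show ?thesis
      using that C(2) B(3,4) unfolding S_def a_def b_def by (auto simp: image_iff)
  qed
  have cS: "c t \<in> S" if "t \<in> I" for t
    using that C(2) unfolding S_def I_def by auto
  have SK: "S \<inter> K = B"
  proof
    show "S \<inter> K \<subseteq> B" using S_cases c\<Omega> K\<Omega>(2) by blast
    show "B \<subseteq> S \<inter> K" using B(5) by (auto simp: S_def)
  qed
  have cpS: "compact S"
    unfolding S_def by (intro compact_Un compact_continuous_image contC B) auto
  have near: "h z \<in> cball (c 0) R" if z: "z \<in> ball 0 1" "q z < exp x" for z
  proof (rule ccontr)
    assume out: "h z \<notin> cball (c 0) R"
    have exX: "exp x < q p / 2" using x expX by (metis exp_less_cancel_iff)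
    have zD: "z \<in> D" using z exX qp by (auto simp: D_def)
    obtain z0 where z0: "z0 \<in> ball 0 1 \<inter> ball p r - {p}" "cmod (c 0) + R < cmod (h z0)"
      using unbdd[OF r(1)] by blast
    have z0D: "z0 \<in> D" using z0 by (auto simp: D_def)
    have qz0: "q z0 > exp x" using r(2)[of z0] z0(1) exX by auto
    have out0: "h z0 \<notin> cball (c 0) R"
      using z0(2) norm_triangle_ineq2[of "h z0" "c 0"] by (simp add: dist_norm norm_minus_commute)
    have "connected (- cball (c 0) R)"
      by (rule connected_complement_bounded_convex) auto
    then have "connected_component (- S) (h z) (h z0)"
      unfolding connected_component_def using SR out out0 by blast
    moreover have "connected_component (- K) (h z) (h z0)"
      unfolding connected_component_def using con\<Omega> K\<Omega> zD z0D by (auto simp: \<Omega>_def)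
    ultimately have "connected_component (- (S \<union> K)) (h z) (h z0)"
      using Janiszewski[OF cpS compact_imp_closed[OF K(1)]] SK B(2) by simp
    then obtain Y where Y: "connected Y" "Y \<subseteq> - (S \<union> K)" "h z \<in> Y" "h z0 \<in> Y"
      unfolding connected_component_def by blast
    \<comment> \<open>a connected set that meets \<open>\<Omega>\<close> and avoids its boundary stays in \<open>\<Omega>\<close>\<close>
    have Y\<Omega>: "Y \<subseteq> \<Omega>"
    proof (rule ccontr)
      assume "\<not> Y \<subseteq> \<Omega>"
      moreover have "Y \<inter> \<Omega> \<noteq> {}" using Y zD by (auto simp: \<Omega>_def)
      ultimately have "Y \<inter> frontier \<Omega> \<noteq> {}"
        using connected_Int_frontier[OF Y(1)] by blast
      then show False using K\<Omega> Y(2) by blast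
    qed
    have gY: "g ` Y \<subseteq> D" using Y\<Omega> hg by auto
    have "connected (g ` Y)"
      using connected_continuous_image[OF continuous_on_subset[OF contg Y\<Omega>] Y(1)] .
    moreover have "continuous_on (g ` Y) q"
      by (rule continuous_on_subset[OF contq]) (use gY in \<open>auto simp: D_def\<close>)
    ultimately have "connected (q ` g ` Y)"
      using connected_continuous_image by blast
    moreover have "q z \<in> q ` g ` Y" "q z0 \<in> q ` g ` Y"
      using Y gh zD z0D by (metis imageI)+
    ultimately have "exp x \<in> q ` g ` Y"
      using connected_contains_Icc[of "q ` g ` Y" "q z" "q z0"] z(2) qz0 by auto
    then obtain v where v: "v \<in> Y" "q (g v) = exp x" by auto
    have gv: "g v \<in> D" using v gY by auto
    then obtain w where w: "\<bar>Im w\<bar> < pi / 2" "g v = T w"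
      using strip_map_surj[OF \<zeta>, of "g v"] by (auto simp: D_def T_def)
    then have "Re w = x"
      using v(2) apollonius_strip_map[OF \<zeta>0 w(1)] by (simp add: q_def T_def)
    then have wx: "w = Complex x (Im w)" "Im w \<in> I"
      using w by (auto simp: complex_eq_iff I_def)
    have "v = h (T w)" using hg v(1) Y\<Omega> w(2) by force
    then have "v = c (Im w)" using wx by (simp add: c_def H_def)
    then show False using cS wx v(1) Y(2) by auto
  qed
  have "2 * R \<le> e" using m by (simp add: R_def)
  show ?thesis
  proof (intro exI[of _ "min 1 (exp x)"] conjI allI impI)
    fix z w assume zw: "z \<in> ball 0 1 \<and> w \<in> ball 0 1 \<and> dist \<zeta> z < min 1 (exp x) \<and> dist \<zeta> w < min 1 (exp x)"
    then have "q z < exp x" "q w < exp x"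
      unfolding q_def by (auto intro!: apollonius_small_near[OF \<zeta>])
    then have "dist (c 0) (h z) \<le> R" "dist (c 0) (h w) \<le> R"
      using near zw by auto
    then show "dist (h z) (h w) \<le> e"
      using dist_triangle3[of "h z" "h w" "c 0"] \<open>2 * R \<le> e\<close> by simp
  qed auto
qed

text \<open>
  The Moebius chart at \<open>f p\<close> turns the sphere boundary of the image of \<open>f\<close> into a compact planar set, to
  which the crosscut argument applies; a vanishing oscillation is Cauchy's criterion for the limit.
\<close>
lemma reciprocal_has_boundary_limit:
  assumes holo: "f holomorphic_on ball 0 1" and inj: "inj_on f (ball 0 1)" and p: "p \<in> ball 0 1"
    and lc: "locally_connected_space (subtopology riemann_sphere (sphere_boundary (f ` ball 0 1)))"
    and \<zeta>: "cmod \<zeta> = 1"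
  shows "\<exists>L. ((\<lambda>z. 1 / (f z - f p)) \<longlongrightarrow> L) (at \<zeta> within ball 0 1)"
proof -
  define h where "h z = 1 / (f z - f p)" for z
  define E where "E = f ` ball 0 1"
  define K where "K = sphere_chart (f p) -` sphere_boundary E"
  have contf: "continuous_on (ball 0 1) f"
    using holo by (rule holomorphic_on_imp_continuous_on)
  have opE: "open E"
    unfolding E_def using invariance_of_domain[OF contf open_ball inj] .
  have pE: "f p \<in> E" using p by (auto simp: E_def)
  have ne: "f z \<noteq> f p" if "z \<in> ball 0 1 - {p}" for z
    using that p inj by (auto dest: inj_onD)
  have \<Omega>: "sphere_chart (f p) -` Some ` E = h ` (ball 0 1 - {p})"
  proof (intro equalityI subsetI)
    fix v assume "v \<in> sphere_chart (f p) -` Some ` E"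
    then obtain z where z: "v \<noteq> 0" "z \<in> ball 0 1" "f p + 1 / v = f z"
      by (auto simp: sphere_chart_def E_def split: if_splits)
    then have "f z - f p = 1 / v" by (simp add: algebra_simps)
    then have "v = h z" "z \<noteq> p" using z(1) by (auto simp: h_def)
    then show "v \<in> h ` (ball 0 1 - {p})" using z by auto
  next
    fix v assume "v \<in> h ` (ball 0 1 - {p})"
    then obtain z where z: "z \<in> ball 0 1 - {p}" "v = h z" by blast
    then show "v \<in> sphere_chart (f p) -` Some ` E"
      using ne[OF z(1)] by (auto simp: sphere_chart_def h_def E_def)
  qed
  note chart = sphere_boundary_in_chart[OF opE pE, folded K_def, unfolded \<Omega>]
  have osc: "\<exists>d>0. \<forall>z w. z \<in> ball 0 1 \<and> w \<in> ball 0 1 \<and> dist \<zeta> z < d \<and> dist \<zeta> w < d \<longrightarrow> dist (h z) (h w) \<le> e"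
    if e: "e > 0" for e
  proof (rule oscillation_small_near_boundary_point[OF p \<zeta> _ _ _ _ chart(2) _ chart(4,3) e])
    show "h holomorphic_on ball 0 1 - {p}"
      unfolding h_def using ne by (intro holomorphic_intros holomorphic_on_subset[OF holo]) auto
    show "inj_on h (ball 0 1 - {p})"
      using inj by (auto simp: h_def inj_on_def)
    show "locally_connected_space (top_of_set K)"
      using chart(5) lc by (simp add: E_def)
    show "bounded (h ` (ball 0 1 - ball p r))" if r: "r > 0" for r
    proof -
      have "open (f ` (ball 0 1 \<inter> ball p r))"
        by (rule invariance_of_domain[OF continuous_on_subset[OF contf] _ inj_on_subset[OF inj]]) auto
      moreover have "f p \<in> f ` (ball 0 1 \<inter> ball p r)" using p r by auto
      ultimately obtain s where s: "s > 0" "ball (f p) s \<subseteq> f ` (ball 0 1 \<inter> ball p r)"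
        by (meson open_contains_ball)
      have "cmod (h z) \<le> 1 / s" if z: "z \<in> ball 0 1 - ball p r" for z
      proof -
        have "f z \<notin> f ` (ball 0 1 \<inter> ball p r)"
          using z inj by (auto dest: inj_onD)
        then have "s \<le> cmod (f z - f p)"
          using s(2) by (auto simp: dist_norm norm_minus_commute not_less subset_eq)
        then show ?thesis
          using s(1) by (simp add: h_def norm_divide frac_le)
      qed
      then show ?thesis
        unfolding bounded_iff by (intro exI[of _ "1 / s"]) blast
    qed
    show "\<exists>z\<in>ball 0 1 \<inter> ball p r - {p}. M < cmod (h z)" if r: "r > 0" for r M
    proof -
      have "filterlim h at_infinity (at p)"
      proof -
        have "((\<lambda>z. f z - f p) \<longlongrightarrow> f p - f p) (at p)"
          using contf p by (intro tendsto_intros) (simp add: continuous_on_eq_continuous_at isContD)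
        moreover have "\<forall>\<^sub>F z in at p. f z - f p \<noteq> 0"
          using eventually_at_in_open[of "ball 0 1" p] p ne by (auto elim!: eventually_mono)
        ultimately show ?thesis
          unfolding h_def divide_inverse mult_1 by (intro filterlim_inverse_at_infinity[THEN filterlim_compose]) (auto simp: filterlim_at)
      qed
      then have "\<forall>\<^sub>F z in at p. M < cmod (h z)"
        using filterlim_at_infinity_imp_norm_at_top[of h "at p"] by (simp add: filterlim_at_top_dense)
      moreover have "\<forall>\<^sub>F z in at p. z \<in> ball 0 1 \<inter> ball p r - {p}"
        using eventually_at_in_open[of "ball 0 1 \<inter> ball p r" p] p r by (auto simp: open_Int)
      ultimately have "\<forall>\<^sub>F z in at p. z \<in> ball 0 1 \<inter> ball p r - {p} \<and> M < cmod (h z)"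
        by (rule eventually_conj[rotated])
      then obtain z where "z \<in> ball 0 1 \<inter> ball p r - {p}" "M < cmod (h z)"
        using eventually_happens[of _ "at p"] by (metis (no_types, lifting) trivial_limit_at)
      then show ?thesis by (intro bexI[of _ z]) auto
    qed
  qed
  have nb: "at \<zeta> within ball 0 1 \<noteq> bot"
    using \<zeta> by (simp add: trivial_limit_within islimpt_ball)
  have "cauchy_filter (filtermap h (at \<zeta> within ball 0 1))"
    unfolding cauchy_filter_metric_filtermap
  proof (intro allI impI)
    fix e :: real assume "e > 0"
    then obtain d where d: "d > 0"
      "\<And>z w. z \<in> ball 0 1 \<and> w \<in> ball 0 1 \<and> dist \<zeta> z < d \<and> dist \<zeta> w < d \<Longrightarrow> dist (h z) (h w) \<le> e / 2"
      using osc[of "e / 2"] by (metis half_gt_zero)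
    show "\<exists>P. eventually P (at \<zeta> within ball 0 1) \<and> (\<forall>x y. P x \<and> P y \<longrightarrow> dist (h x) (h y) < e)"
    proof (intro exI[of _ "\<lambda>z. z \<in> ball 0 1 \<and> dist \<zeta> z < d"] conjI allI impI)
      show "\<forall>\<^sub>F z in at \<zeta> within ball 0 1. z \<in> ball 0 1 \<and> dist \<zeta> z < d"
        unfolding eventually_at using d(1) by (auto simp: dist_commute)
      fix z w assume "(z \<in> ball 0 1 \<and> dist \<zeta> z < d) \<and> (w \<in> ball 0 1 \<and> dist \<zeta> w < d)"
      then show "dist (h z) (h w) < e"
        using d(2)[of z w] \<open>e > 0\<close> by simp
    qed
  qed
  moreover have "filtermap h (at \<zeta> within ball 0 1) \<noteq> bot"
    using nb by (simp add: filtermap_bot_iff)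
  ultimately obtain L where "filtermap h (at \<zeta> within ball 0 1) \<le> nhds L"
    using complete_uniform[of "UNIV::complex set"] complete_UNIV by force
  then show ?thesis
    unfolding h_def[abs_def, symmetric] by (auto simp: filterlim_def h_def[abs_def])
qed


section \<open>Transition maps\<close>

text \<open>
  Limits along the open disk suffice: a bound for the values in the disk near a boundary point passes to the
  limits at the neighbouring boundary points.
\<close>
lemma continuous_extension_from_boundary_limits:
  fixes k :: "complex \<Rightarrow> complex"
  assumes cont: "continuous_on (ball 0 1) k"
    and lim: "\<And>\<zeta>. cmod \<zeta> = 1 \<Longrightarrow> \<exists>L. (k \<longlongrightarrow> L) (at \<zeta> within ball 0 1)"
  obtains g where "continuous_on (cball 0 1) g" "\<And>z. z \<in> ball 0 1 \<Longrightarrow> g z = k z"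
proof -
  define g where "g z = (if z \<in> ball 0 1 then k z else Lim (at z within ball 0 1) k)" for z
  have nb: "at z within ball 0 1 \<noteq> bot" if "z \<in> cball 0 1" for z :: complex
    using that by (simp add: trivial_limit_within islimpt_ball)
  have lim_g: "(k \<longlongrightarrow> g z) (at z within ball 0 1)" if z: "z \<in> cball 0 1" for z
  proof (cases "z \<in> ball 0 1")
    case True
    then show ?thesis using cont by (simp add: g_def continuous_on_def)
  next
    case False
    then obtain L where L: "(k \<longlongrightarrow> L) (at z within ball 0 1)"
      using lim[of z] z by auto
    then have "Lim (at z within ball 0 1) k = L"
      using tendsto_Lim[OF nb[OF z]] by blast
    then show ?thesis using L False by (simp only: g_def if_False)
  qed
  have "continuous_on (cball 0 1) g"
    unfolding continuous_on_iff
  proof (intro ballI allI impI)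
    fix z :: complex and e :: real assume z: "z \<in> cball 0 1" and e: "e > 0"
    obtain d where d: "d > 0" "\<And>w. w \<in> ball 0 1 \<Longrightarrow> dist w z < d \<Longrightarrow> dist (k w) (g z) < e / 2"
    proof -
      obtain d where d: "d > 0" "\<And>w. w \<in> ball 0 1 \<Longrightarrow> w \<noteq> z \<Longrightarrow> dist w z < d \<Longrightarrow> dist (k w) (g z) < e / 2"
        using lim_g[OF z] e unfolding Lim_within by (metis half_gt_zero zero_less_dist_iff)
      have "dist (k z) (g z) < e / 2" if "z \<in> ball 0 1"
        using that e by (simp add: g_def)
      then show ?thesis using that[of d] d by metis
    qed
    show "\<exists>d>0. \<forall>w\<in>cball 0 1. dist w z < d \<longrightarrow> dist (g w) (g z) < e"
    proof (intro exI[of _ d] conjI ballI impI)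
      fix w :: complex assume w: "w \<in> cball 0 1" "dist w z < d"
      have "dist (g w) (g z) \<le> e / 2"
      proof (rule tendsto_upperbound[OF tendsto_dist[OF lim_g[OF w(1)] tendsto_const] _ nb[OF w(1)]])
        have "\<forall>\<^sub>F v in at w within ball 0 1. v \<in> ball z d"
          using w(2) eventually_at_in_open'[of "ball z d" w] by (auto simp: eventually_at_topological dist_commute intro: exI[of _ "ball z d"])
        then show "\<forall>\<^sub>F v in at w within ball 0 1. dist (k v) (g z) \<le> e / 2"
          unfolding eventually_at_filter
          by eventually_elim (use d(2) in \<open>auto simp: dist_commute less_imp_le\<close>)
      qed
      then show "dist (g w) (g z) < e" using e by simp
    qed (rule d(1))
  qed
  then show ?thesis using that[of g] by (simp add: g_def)
qed

text \<open>
  Multiplying \<open>1/(g z - g p)\<close> by \<open>z - p\<close> removes its simple pole, so that the boundary behaviour of \<open>g\<close>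
  is recorded by a single function in the disk algebra. Its value at \<open>p\<close> is \<open>1/g' p\<close>, which makes it
  useful for showing that combinations of it are not identically zero.
\<close>
lemma reciprocal_extends_to_closed_disk:
  assumes holo: "g holomorphic_on ball 0 1" and inj: "inj_on g (ball 0 1)" and p: "p \<in> ball 0 1"
    and lc: "locally_connected_space (subtopology riemann_sphere (sphere_boundary (g ` ball 0 1)))"
  obtains k where "continuous_on (cball 0 1) k" "k holomorphic_on ball 0 1" "k p \<noteq> 0"
    "\<And>z. z \<in> ball 0 1 - {p} \<Longrightarrow> k z = (z - p) / (g z - g p)"
proof -
  have ne: "g z \<noteq> g p" if "z \<in> ball 0 1 - {p}" for z
    using that p inj by (auto dest: inj_onD)
  define c where "c = 1 / deriv g p"
  have d0: "deriv g p \<noteq> 0"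
    by (rule holomorphic_injective_imp_regular[OF holo open_ball inj p])
  define k where "k z = (if z = p then c else (z - p) / (g z - g p))" for z
  have "(g has_field_derivative deriv g p) (at p)"
    using holo p holomorphic_derivI by blast
  then have der: "((\<lambda>z. (g z - g p) / (z - p)) \<longlongrightarrow> deriv g p) (at p)"
    by (simp add: has_field_derivative_iff)
  have "((\<lambda>z. inverse ((g z - g p) / (z - p))) \<longlongrightarrow> c) (at p)"
    unfolding c_def using tendsto_inverse[OF der d0] by (simp add: inverse_eq_divide)
  then have lim: "((\<lambda>z. (z - p) / (g z - g p)) \<longlongrightarrow> c) (at p)"
    by simp
  have holok: "k holomorphic_on ball 0 1"
    unfolding k_def
  proof (rule removable_singularity[OF _ open_ball lim])
    show "(\<lambda>z. (z - p) / (g z - g p)) holomorphic_on ball 0 1 - {p}"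
      using ne by (intro holomorphic_intros holomorphic_on_subset[OF holo]) auto
  qed
  have "\<exists>L. (k \<longlongrightarrow> L) (at \<zeta> within ball 0 1)" if \<zeta>: "cmod \<zeta> = 1" for \<zeta>
  proof -
    obtain L where L: "((\<lambda>z. 1 / (g z - g p)) \<longlongrightarrow> L) (at \<zeta> within ball 0 1)"
      using reciprocal_has_boundary_limit[OF holo inj p lc \<zeta>] by blast
    have "((\<lambda>z. (z - p) * (1 / (g z - g p))) \<longlongrightarrow> (\<zeta> - p) * L) (at \<zeta> within ball 0 1)"
      by (intro tendsto_intros L)
    moreover have "\<forall>\<^sub>F z in at \<zeta> within ball 0 1. (z - p) * (1 / (g z - g p)) = k z"
    proof -
      have "\<forall>\<^sub>F z in at \<zeta> within ball 0 1. z \<noteq> p"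
        using \<zeta> p by (intro eventually_neq_at_within)
      then show ?thesis by eventually_elim (simp add: k_def)
    qed
    ultimately show ?thesis
      using Lim_transform_eventually by blast
  qed
  then obtain K where K: "continuous_on (cball 0 1) K" "\<And>z. z \<in> ball 0 1 \<Longrightarrow> K z = k z"
    using continuous_extension_from_boundary_limits[OF holomorphic_on_imp_continuous_on[OF holok]] by metis
  show ?thesis
  proof (rule that[OF K(1)])
    show "K holomorphic_on ball 0 1"
      by (rule holomorphic_transform[OF holok]) (simp add: K(2))
    show "K p \<noteq> 0" using K(2)[OF p] d0 by (simp add: k_def c_def)
    show "K z = (z - p) / (g z - g p)" if "z \<in> ball 0 1 - {p}" for z
      using K(2)[of z] that by (simp add: k_def)
  qed
qed

text \<open>
  The cluster set of \<open>\<phi>\<close> at \<open>\<zeta>\<close> is a decreasing intersection of continua, hence a continuum, and \<open>Z\<close>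
  vanishes on it. As \<open>Z\<close> is not identically zero, the cluster set is a single point.
\<close>
lemma limit_at_boundary_if_clusters_in_zero_set:
  fixes \<phi> :: "complex \<Rightarrow> complex"
  assumes cont: "continuous_on (ball 0 1) \<phi>" and im: "\<phi> ` ball 0 1 \<subseteq> ball 0 1" and \<zeta>: "cmod \<zeta> = 1"
    and Z: "continuous_on (cball 0 1) Z" "Z holomorphic_on ball 0 1" "p \<in> ball 0 1" "Z p \<noteq> 0"
    and lim: "((\<lambda>z. Z (\<phi> z)) \<longlongrightarrow> 0) (at \<zeta> within ball 0 1)"
  shows "\<exists>c. (\<phi> \<longlongrightarrow> c) (at \<zeta> within ball 0 1)"
proof -
  define r where "r n = 1 / real (Suc n)" for n
  have r: "r n > 0" for n by (simp add: r_def)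
  have r_mono: "r n \<le> r m" if "m \<le> n" for m n
    using that by (simp add: r_def frac_le)
  define N where "N n = ball 0 1 \<inter> ball \<zeta> (r n)" for n
  define S where "S n = closure (\<phi> ` N n)" for n
  have sub: "S n \<subseteq> cball 0 1" for n
    unfolding S_def using im by (intro closure_minimal) (auto simp: N_def image_subset_iff less_imp_le)
  have comp: "compact (S n)" for n
    using sub[of n] by (simp add: S_def compact_eq_bounded_closed bounded_subset[OF bounded_cball])
  have conn: "connected (S n)" for n
    unfolding S_def N_def
    by (intro connected_imp_connected_closure connected_continuous_image continuous_on_subset[OF cont]
          convex_connected convex_Int) auto
  have mono: "S n \<subseteq> S m" if "m \<le> n" for m n
    unfolding S_def N_def using r_mono[OF that] by (intro closure_mono image_mono) auto
  have "N n \<noteq> {}" for n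
  proof -
    have "\<zeta> \<in> closure (ball 0 1)" using \<zeta> by simp
    then obtain y where "y \<in> ball 0 1" "dist y \<zeta> < r n"
      unfolding closure_approachable using r[of n] by blast
    then have "y \<in> N n" by (simp add: N_def dist_commute)
    then show ?thesis by blast
  qed
  then have ne: "S n \<noteq> {}" for n by (simp add: S_def)
  define C where "C = \<Inter> (range S)"
  have "C \<noteq> {}" unfolding C_def using compact_nest[of S] comp ne mono by blast
  then obtain c where c: "c \<in> C" by blast
  have "connected C" unfolding C_def using connected_nest[of S] comp conn mono by blast
  have C_sub: "C \<subseteq> cball 0 1" unfolding C_def using sub by blast
  have zero: "Z w = 0" if w: "w \<in> C" for w
  proof (rule ccontr)
    assume "Z w \<noteq> 0"
    define e where "e = cmod (Z w) / 2"
    have e: "e > 0" using \<open>Z w \<noteq> 0\<close> by (simp add: e_def)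
    obtain d where d: "d > 0" "\<And>v. v \<in> cball 0 1 \<Longrightarrow> dist v w < d \<Longrightarrow> dist (Z v) (Z w) < e"
      using Z(1) e w C_sub unfolding continuous_on_iff by (meson subsetD)
    obtain \<delta> where \<delta>: "\<delta> > 0" "\<And>z. z \<in> ball 0 1 \<Longrightarrow> dist z \<zeta> < \<delta> \<Longrightarrow> cmod (Z (\<phi> z)) < e"
    proof -
      obtain \<delta> where \<delta>: "\<delta> > 0" "\<And>z. z \<in> ball 0 1 \<Longrightarrow> 0 < dist z \<zeta> \<Longrightarrow> dist z \<zeta> < \<delta> \<Longrightarrow> cmod (Z (\<phi> z)) < e"
        using lim e unfolding Lim_within by (metis dist_0_norm dist_commute)
      moreover have "0 < dist z \<zeta>" if "z \<in> ball 0 1" for z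
        using that \<zeta> by auto
      ultimately show ?thesis using that by blast
    qed
    obtain n where n: "r n < \<delta>"
      unfolding r_def using \<delta>(1) nat_approx_posE by blast
    have "w \<in> S n" using w by (auto simp: C_def)
    then obtain z where z: "z \<in> N n" "dist (\<phi> z) w < d"
      unfolding S_def closure_approachable using d(1) by blast
    then have zb: "z \<in> ball 0 1" "dist z \<zeta> < \<delta>" using n by (auto simp: N_def dist_commute)
    have "\<phi> z \<in> cball 0 1" using im zb(1) by (auto simp: image_subset_iff less_imp_le)
    then have "dist (Z (\<phi> z)) (Z w) < e" using d(2) z(2) by blast
    moreover have "cmod (Z (\<phi> z)) < e" using \<delta>(2) zb by blast
    ultimately show False
      using norm_triangle_ineq2[of "Z w" "Z (\<phi> z)"] by (simp add: e_def dist_norm norm_minus_commute)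
  qed
  have single: "w = c" if "w \<in> C" for w
  proof (rule ccontr)
    assume "w \<noteq> c"
    then show False
      using zero_on_continuum_imp_zero[OF Z(1,2) \<open>connected C\<close> C_sub that c _ zero Z(3)] Z(4) by blast
  qed
  have "(\<phi> \<longlongrightarrow> c) (at \<zeta> within ball 0 1)"
    unfolding tendsto_iff
  proof (intro allI impI)
    fix e :: real assume e: "e > 0"
    have "\<exists>n. S n - ball c e = {}"
    proof (rule ccontr)
      assume "\<not> ?thesis"
      then have "\<Inter> (range (\<lambda>n. S n - ball c e)) \<noteq> {}"
      proof (intro compact_nest)
        show "compact (S n - ball c e)" for n using comp by (intro compact_diff) auto
        show "S n - ball c e \<subseteq> S m - ball c e" if "m \<le> n" for m n using mono[OF that] by blast
      qed blast
      then obtain w where "\<And>n. w \<in> S n - ball c e" by blast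
      then have "w \<in> C" "w \<notin> ball c e" by (auto simp: C_def)
      then show False using single e by auto
    qed
    then obtain n where n: "S n \<subseteq> ball c e" by blast
    have "\<forall>\<^sub>F z in at \<zeta> within ball 0 1. z \<in> N n"
      unfolding eventually_at N_def using r[of n] by (auto simp: dist_commute)
    then show "\<forall>\<^sub>F z in at \<zeta> within ball 0 1. dist (\<phi> z) c < e"
    proof eventually_elim
      case (elim z)
      then have "\<phi> z \<in> S n" 
        unfolding S_def by (intro subsetD[OF closure_subset] imageI)
      then have "\<phi> z \<in> ball c e" using n by blast
      then show ?case by (simp add: dist_commute)
    qed
  qed
  then show ?thesis by blast
qed


text \<open>
  At a boundary point where \<open>1/(f z - f 0)\<close> tends to \<open>L\<close>, the function \<open>Z w = k w - (w - p) L\<close> detects the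
  cluster points \<open>w\<close> of \<open>\<phi>\<close>, because \<open>k (\<phi> z) = (\<phi> z - p)/(f z - f 0)\<close>. The formulation without the pole
  also excludes \<open>w = p\<close> as a cluster point, since \<open>Z p = k p \<noteq> 0\<close>.
\<close>
lemma transition_map_in_disk_algebra:
  assumes f: "f holomorphic_on unit_disk" "inj_on f unit_disk"
    and g: "g holomorphic_on unit_disk" "inj_on g unit_disk"
    and sub: "f ` unit_disk \<subseteq> g ` unit_disk"
    and lcf: "locally_connected_space (subtopology riemann_sphere (sphere_boundary (f ` unit_disk)))"
    and lcg: "locally_connected_space (subtopology riemann_sphere (sphere_boundary (g ` unit_disk)))"
  shows "the_inv_into unit_disk g \<circ> f \<in> disk_algebra"
proof -
  define \<phi> where "\<phi> = the_inv_into unit_disk g \<circ> f"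
  have \<phi>: "\<phi> z \<in> unit_disk" "g (\<phi> z) = f z" if "z \<in> unit_disk" for z
    using that sub the_inv_into_into[OF g(2) _ order_refl] f_the_inv_into_f[OF g(2)]
    unfolding \<phi>_def o_def by blast+
  have holo: "\<phi> holomorphic_on unit_disk"
  proof -
    obtain G where G: "G holomorphic_on g ` unit_disk" "\<And>z. z \<in> unit_disk \<Longrightarrow> G (g z) = z"
      using holomorphic_has_inverse[OF g(1) open_ball g(2)] by metis
    have "G \<circ> f holomorphic_on unit_disk"
      using holomorphic_on_compose_gen[OF f(1) G(1)] sub by (simp add: image_subset_iff)
    moreover have "(G \<circ> f) z = \<phi> z" if "z \<in> unit_disk" for z
      using G(2)[OF \<phi>(1)[OF that]] \<phi>(2)[OF that] by simp
    ultimately show ?thesis by (metis holomorphic_transform)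
  qed
  have cont: "continuous_on unit_disk \<phi>" using holo by (rule holomorphic_on_imp_continuous_on)
  have 0: "(0::complex) \<in> unit_disk" by simp
  define p where "p = \<phi> 0"
  have p: "p \<in> unit_disk" "g p = f 0" using \<phi>[OF 0] by (simp_all add: p_def)
  obtain k where k: "continuous_on (cball 0 1) k" "k holomorphic_on unit_disk" "k p \<noteq> 0"
    "\<And>z. z \<in> unit_disk - {p} \<Longrightarrow> k z = (z - p) / (g z - g p)"
    using reciprocal_extends_to_closed_disk[OF g p(1) lcg] by metis
  have "\<exists>c. (\<phi> \<longlongrightarrow> c) (at \<zeta> within unit_disk)" if \<zeta>: "cmod \<zeta> = 1" for \<zeta>
  proof -
    obtain L where L: "((\<lambda>z. 1 / (f z - f 0)) \<longlongrightarrow> L) (at \<zeta> within unit_disk)"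
      using reciprocal_has_boundary_limit[OF f 0 lcf \<zeta>] by blast
    define Z where "Z w = k w - (w - p) * L" for w
    have id: "Z (\<phi> z) = (\<phi> z - p) * (1 / (f z - f 0) - L)" if z: "z \<in> unit_disk" "z \<noteq> 0" for z
    proof -
      have "\<phi> z \<noteq> p"
        using z \<phi>(2)[OF z(1)] p(2) f(2) 0 by (metis inj_onD)
      then show ?thesis
        using k(4)[of "\<phi> z"] \<phi>[OF z(1)] p(2) by (simp add: Z_def right_diff_distrib)
    qed
    show ?thesis
    proof (rule limit_at_boundary_if_clusters_in_zero_set[OF cont _ \<zeta> _ _ p(1)])
      show "\<phi> ` unit_disk \<subseteq> unit_disk" using \<phi> by blast
      show "continuous_on (cball 0 1) Z" unfolding Z_def by (intro continuous_intros k)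
      show "Z holomorphic_on unit_disk" unfolding Z_def by (intro holomorphic_intros k)
      show "Z p \<noteq> 0" using k(3) by (simp add: Z_def)
      have "((\<lambda>z. (\<phi> z - p) * (1 / (f z - f 0) - L)) \<longlongrightarrow> 0) (at \<zeta> within unit_disk)"
      proof (rule Lim_null_comparison)
        show "((\<lambda>z. 2 * cmod (1 / (f z - f 0) - L)) \<longlongrightarrow> 0) (at \<zeta> within unit_disk)"
          using tendsto_mult_right_zero[OF tendsto_norm_zero[OF LIM_zero[OF L]]] by simp
        have "cmod ((\<phi> z - p) * (1 / (f z - f 0) - L)) \<le> 2 * cmod (1 / (f z - f 0) - L)"
          if "z \<in> unit_disk" for z
        proof -
          have "cmod (\<phi> z - p) \<le> 2"
            using \<phi>(1)[OF that] p(1) norm_triangle_ineq4[of "\<phi> z" p] by simp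
          then show ?thesis by (simp add: norm_mult mult_right_mono)
        qed
        then show "\<forall>\<^sub>F z in at \<zeta> within unit_disk.
            cmod ((\<phi> z - p) * (1 / (f z - f 0) - L)) \<le> 2 * cmod (1 / (f z - f 0) - L)"
          unfolding eventually_at by (intro exI[of _ 1]) auto
      qed
      moreover have "\<forall>\<^sub>F z in at \<zeta> within unit_disk. (\<phi> z - p) * (1 / (f z - f 0) - L) = Z (\<phi> z)"
      proof -
        have "\<forall>\<^sub>F z in at \<zeta> within unit_disk. z \<noteq> 0 \<and> z \<in> unit_disk"
          unfolding eventually_at using \<zeta> by (intro exI[of _ 1]) (auto simp: dist_norm)
        then show ?thesis by eventually_elim (metis id)
      qed
      ultimately show "((\<lambda>z. Z (\<phi> z)) \<longlongrightarrow> 0) (at \<zeta> within unit_disk)"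
        by (rule Lim_transform_eventually)
    qed
  qed
  then obtain G where "continuous_on (cball 0 1) G" "\<And>z. z \<in> unit_disk \<Longrightarrow> G z = \<phi> z"
    using continuous_extension_from_boundary_limits[OF cont] by metis
  then show ?thesis
    unfolding disk_algebra_def \<phi>_def[symmetric] using holo by blast
qed

theorem theorem8p1:
  fixes f :: "real \<Rightarrow> complex \<Rightarrow> complex"
  assumes "loewner_chain f"
    and "\<forall>t\<ge>0. locally_connected_space
           (subtopology riemann_sphere (sphere_boundary (f t ` unit_disk)))"
  shows "\<forall>s\<ge>0. \<forall>t\<ge>s. evolution_family f s t \<in> disk_algebra"
proof (intro allI impI)
  fix s t :: real assume st: "0 \<le> s" "s \<le> t"
  obtain d where d: "loewner_chain_of_order d f"
    using assms(1) unfolding loewner_chain_def by blast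
  note LC = d[unfolded loewner_chain_of_order_def]
  have t: "0 \<le> t" using st by linarith
  have fam: "f u holomorphic_on unit_disk" "inj_on (f u) unit_disk" if "0 \<le> u" for u
    using conjunct1[OF LC] that by simp_all
  have sub: "f s ` unit_disk \<subseteq> f t ` unit_disk"
    using conjunct1[OF conjunct2[OF LC]] st by simp
  have lc: "locally_connected_space (subtopology riemann_sphere (sphere_boundary (f u ` unit_disk)))"
    if "0 \<le> u" for u
    using assms(2) that by simp
  show "evolution_family f s t \<in> disk_algebra"
    unfolding evolution_family_def
    by (rule transition_map_in_disk_algebra[OF fam[OF st(1)] fam[OF t] sub lc[OF st(1)] lc[OF t]])
qed

end
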